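(* Let $(S_7,\cdot)$ be the three-element commutative monoid $\{0,a,1\}$ with identity $1$, zero $0$ and $a\cdot a=0$. The variety $\mathsf{V}(\mathcal{P}^+(S_7,\cdot))$ generated by the nonempty power semiring $\mathcal{P}^+(S_7,\cdot)$ is exactly the variety of all commutative ai-semirings satisfying the following identities and inequalities, where $\mathbf{q}_{n,k}=x_1x_2\cdots x_k x_{k+1}^2\cdots x_{n+1}^2$: (1) $x^3\approx x^2$; (2) $x_1^2x_2^2\cdots x_{n+1}^2\preceq \sum_{i=1}^{n+1}x_i^2\mathbf{w}_i$, for all $n\ge 1$; (3) $x_1^2x_2^2\cdots x_{n+1}^2\preceq \sum_{i=1}^{n+1}x_i\mathbf{w}_i+\sum_{i=1}^{n+1}x_i^2\mathbf{p}_i$, for all $n\ge 1$; (4) $\mathbf{q}_{n,k}\preceq \sum_{i=1}^{n+1}x_i\mathbf{w}_i+\sum_{i=1}^{k-1}x_i^2\mathbf{p}_i+\sum_{i=k+1}^{n+1}x_i^2\mathbf{p}_i$, for all $n\ge1$ and $1\le k\le n+1$; (5) $\mathbf{q}_{n,k}\preceq \sum_{i=1}^{n+1}x_i\mathbf{w}_i+\sum_{i=1}^{\ell}x_i^2\mathbf{p}_i+\sum_{\ell+1\le i<j\le k}x_ix_j\mathbf{p}_{ij}+\sum_{i=k+1}^{n+1}x_i^2\mathbf{p}_i$, for all $n\ge1$, $1\le k\le n+1$ and $0\le \ell<k-1$. Here all $\mathbf{w}_i,\mathbf{p}_i,\mathbf{p}_{ij}$ are commutative words over $X$ that may be empty;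 the $\mathbf{p}_i$ and $\mathbf{p}_{ij}$ are otherwise arbitrary. In (2) and (3), $\mathbf{w}_i$ ranges over all words with $c(\mathbf{w}_i)\subseteq\{x_1,\dots,x_{n+1}\}$. In (4) and (5), $\mathbf{w}_i$ ranges over all words with $c(\mathbf{w}_i)\subseteq\{x_1,\dots,x_{n+1}\}\setminus\{x_i\}$ for $1\le i\le k$ and $c(\mathbf{w}_i)\subseteq\{x_1,\dots,x_{n+1}\}$ for $k+1\le i\le n+1$, and $c(\mathbf{q}_{n,k})=c\bigl(\sum_{i=1}^{n+1}x_i\mathbf{w}_i\bigr)$.
   Context: An ai-semiring is an algebra $(S,+,\cdot)$ with $(S,+)$ a commutative idempotent semigroup, $(S,\cdot)$ a semigroup, and multiplication distributing over addition on both sides; it is commutative if $\cdot$ is commutative. No constants are in the signature. For a semigroup $S$, $\mathcal{P}^+(S)$ is the ai-semiring of all nonempty subsets of $S$ with $A+B=A\cup B$ and $AB=\{ab\mid a\in A,b\in B\}$. $\mathsf{V}(A)$ is the variety generated by $A$. $X$ is a countably infinite set of variables, whose members include the pairwise distinct variables $x,x_1,x_2,\dots$. $X_c^+$ is the free commutative semigroup over $X$ (its elements are called words). Terms are finite nonempty sets of words, written as formal sums; $c(\cdot)$ denotes the set of variables occurring in a word or term (empty for the empty word). For terms $\mathbf{u},\mathbf{v}$, the inequality $\mathbf{u}\preceq\mathbf{v}$ denotes the identity $\mathbf{v}\approx\mathbf{v}+\mathbf{u}$. Empty sums are simply omitted. *)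

theory Defs
  imports "HOL-Library.Multiset" "HOL-Library.FuncSet"
begin

section \<open>Algebras with two binary operations\<close>

record 'a alg =
  carr :: "'a set"
  add :: "'a \<Rightarrow> 'a \<Rightarrow> 'a" (infixl "\<oplus>\<index>" 65)
  mul :: "'a \<Rightarrow> 'a \<Rightarrow> 'a" (infixl "\<otimes>\<index>" 70)

definition comm_ai_semiring :: "'a alg \<Rightarrow> bool" where
  "comm_ai_semiring S \<longleftrightarrow>
     carr S \<noteq> {} \<and>
     (\<forall>x\<in>carr S. \<forall>y\<in>carr S. x \<oplus>\<^bsub>S\<^esub> y \<in> carr S \<and> x \<otimes>\<^bsub>S\<^esub> y \<in> carr S) \<and>
     (\<forall>x\<in>carr S. \<forall>y\<in>carr S. \<forall>z\<in>carr S. (x \<oplus>\<^bsub>S\<^esub> y) \<oplus>\<^bsub>S\<^esub> z = x \<oplus>\<^bsub>S\<^esub> (y \<oplus>\<^bsub>S\<^esub> z)) \<and>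
     (\<forall>x\<in>carr S. \<forall>y\<in>carr S. x \<oplus>\<^bsub>S\<^esub> y = y \<oplus>\<^bsub>S\<^esub> x) \<and>
     (\<forall>x\<in>carr S. x \<oplus>\<^bsub>S\<^esub> x = x) \<and>
     (\<forall>x\<in>carr S. \<forall>y\<in>carr S. \<forall>z\<in>carr S. (x \<otimes>\<^bsub>S\<^esub> y) \<otimes>\<^bsub>S\<^esub> z = x \<otimes>\<^bsub>S\<^esub> (y \<otimes>\<^bsub>S\<^esub> z)) \<and>
     (\<forall>x\<in>carr S. \<forall>y\<in>carr S. x \<otimes>\<^bsub>S\<^esub> y = y \<otimes>\<^bsub>S\<^esub> x) \<and>
     (\<forall>x\<in>carr S. \<forall>y\<in>carr S. \<forall>z\<in>carr S. x \<otimes>\<^bsub>S\<^esub> (y \<oplus>\<^bsub>S\<^esub> z) = x \<otimes>\<^bsub>S\<^esub> y \<oplus>\<^bsub>S\<^esub> x \<otimes>\<^bsub>S\<^esub> z) \<and>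
     (\<forall>x\<in>carr S. \<forall>y\<in>carr S. \<forall>z\<in>carr S. (x \<oplus>\<^bsub>S\<^esub> y) \<otimes>\<^bsub>S\<^esub> z = x \<otimes>\<^bsub>S\<^esub> z \<oplus>\<^bsub>S\<^esub> y \<otimes>\<^bsub>S\<^esub> z)"

definition alg_hom :: "'a alg \<Rightarrow> 'b alg \<Rightarrow> ('a \<Rightarrow> 'b) set" where
  "alg_hom A B = {h. h \<in> carr A \<rightarrow> carr B \<and>
     (\<forall>x\<in>carr A. \<forall>y\<in>carr A. h (x \<oplus>\<^bsub>A\<^esub> y) = h x \<oplus>\<^bsub>B\<^esub> h y \<and>
                               h (x \<otimes>\<^bsub>A\<^esub> y) = h x \<otimes>\<^bsub>B\<^esub> h y)}"

definition subalg :: "'a alg \<Rightarrow> 'a alg \<Rightarrow> bool" where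
  "subalg C A \<longleftrightarrow> carr C \<noteq> {} \<and> carr C \<subseteq> carr A \<and> add C = add A \<and> mul C = mul A \<and>
     (\<forall>x\<in>carr C. \<forall>y\<in>carr C. x \<oplus>\<^bsub>C\<^esub> y \<in> carr C \<and> x \<otimes>\<^bsub>C\<^esub> y \<in> carr C)"

definition direct_power :: "'i set \<Rightarrow> 'a alg \<Rightarrow> ('i \<Rightarrow> 'a) alg" where
  "direct_power I A =
     \<lparr>carr = I \<rightarrow>\<^sub>E carr A,
      add = (\<lambda>f g. \<lambda>i\<in>I. f i \<oplus>\<^bsub>A\<^esub> g i),
      mul = (\<lambda>f g. \<lambda>i\<in>I. f i \<otimes>\<^bsub>A\<^esub> g i)\<rparr>"

definition image_of_subpower :: "'i set \<Rightarrow> 'a alg \<Rightarrow> 'b alg \<Rightarrow> bool" where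
  "image_of_subpower I A B \<longleftrightarrow>
     (\<exists>C h. subalg C (direct_power I A) \<and> h \<in> alg_hom C B \<and> h ` carr C = carr B)"

text \<open>
  The variety generated by \<open>A\<close>, that is \<open>HSP(A)\<close>: all homomorphic images of subalgebras of
  direct powers of \<open>A\<close>. A definition cannot quantify over the type of the index set; fixing it
  to \<open>'b \<Rightarrow> 'a\<close> for the members with elements in \<open>'b\<close> loses nothing, by lemma
  \<open>generated_varietyI\<close> below.
\<close>

definition generated_variety :: "'a alg \<Rightarrow> 'b alg set" where
  "generated_variety A = {B. \<exists>I :: ('b \<Rightarrow> 'a) set. image_of_subpower I A B}"

lemma generated_varietyI:
  fixes I :: "'i set" and A :: "'a alg" and B :: "'b alg"
  assumes "image_of_subpower I A B"
  shows "B \<in> generated_variety A"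
proof -
  obtain C h where C: "subalg C (direct_power I A)" and h: "h \<in> alg_hom C B"
    and sur: "h ` carr C = carr B"
    using assms unfolding image_of_subpower_def by blast
  define s where "s b = (SOME c. c \<in> carr C \<and> h c = b)" for b
  have s: "s b \<in> carr C \<and> h (s b) = b" if "b \<in> carr B" for b
  proof -
    have "\<exists>c. c \<in> carr C \<and> h c = b" using sur that by (metis imageE)
    then show ?thesis unfolding s_def by (rule someI_ex)
  qed
  define e where "e i = (\<lambda>b. if b \<in> carr B then s b i else undefined)" for i
  define J where "J = e ` I"
  define p where "p f = (\<lambda>i\<in>I. f (e i))" for f :: "('b \<Rightarrow> 'a) \<Rightarrow> 'a"
  define D where "D = \<lparr>carr = {f \<in> carr (direct_power J A). p f \<in> carr C},
     add = add (direct_power J A), mul = mul (direct_power J A)\<rparr>"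
  have Cadd: "add C = (\<lambda>f g. \<lambda>i\<in>I. f i \<oplus>\<^bsub>A\<^esub> g i)" and Cmul: "mul C = (\<lambda>f g. \<lambda>i\<in>I. f i \<otimes>\<^bsub>A\<^esub> g i)"
    and Csub: "carr C \<subseteq> (I \<rightarrow>\<^sub>E carr A)" and Cne: "carr C \<noteq> {}"
    and Ccl: "\<And>x y. x \<in> carr C \<Longrightarrow> y \<in> carr C \<Longrightarrow> x \<oplus>\<^bsub>C\<^esub> y \<in> carr C \<and> x \<otimes>\<^bsub>C\<^esub> y \<in> carr C"
    using C unfolding subalg_def direct_power_def by auto
  have eJ: "i \<in> I \<Longrightarrow> e i \<in> J" for i unfolding J_def by auto
  have padd: "p (f \<oplus>\<^bsub>D\<^esub> g) = p f \<oplus>\<^bsub>C\<^esub> p g" and pmul: "p (f \<otimes>\<^bsub>D\<^esub> g) = p f \<otimes>\<^bsub>C\<^esub> p g" for f g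
    by (auto simp: p_def D_def direct_power_def Cadd Cmul eJ intro!: ext)
  have point: "x i \<in> carr A" if "x \<in> carr C" "i \<in> I" for x i
    using Csub that by (auto simp: PiE_iff)
  have cl: "f \<oplus>\<^bsub>D\<^esub> g \<in> carr D \<and> f \<otimes>\<^bsub>D\<^esub> g \<in> carr D" if "f \<in> carr D" "g \<in> carr D" for f g
  proof -
    have pf: "p f \<in> carr C" "p g \<in> carr C" using that by (auto simp: D_def)
    have q: "p (f \<oplus>\<^bsub>D\<^esub> g) \<in> carr C" "p (f \<otimes>\<^bsub>D\<^esub> g) \<in> carr C"
      using Ccl[OF pf] by (auto simp: padd pmul)
    have "f j \<oplus>\<^bsub>A\<^esub> g j \<in> carr A \<and> f j \<otimes>\<^bsub>A\<^esub> g j \<in> carr A" if "j \<in> J" for j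
    proof -
      obtain i where i: "i \<in> I" "j = e i" using \<open>j \<in> J\<close> unfolding J_def by auto
      show ?thesis
        using point[OF q(1) i(1)] point[OF q(2) i(1)] i eJ
        by (auto simp: p_def D_def direct_power_def)
    qed
    then have "f \<oplus>\<^bsub>D\<^esub> g \<in> carr (direct_power J A)" "f \<otimes>\<^bsub>D\<^esub> g \<in> carr (direct_power J A)"
      by (auto simp: D_def direct_power_def)
    with q show ?thesis by (auto simp: D_def)
  qed
  have onto: "\<exists>f\<in>carr D. p f = s b" if b: "b \<in> carr B" for b
  proof
    let ?f = "\<lambda>j\<in>J. j b"
    have sb: "s b \<in> I \<rightarrow>\<^sub>E carr A" using s[OF b] Csub by auto
    show pe: "p ?f = s b"
    proof
      fix i show "p ?f i = s b i"
        using eJ sb b by (cases "i \<in> I") (auto simp: p_def e_def PiE_iff extensional_def)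
    qed
    have "j b \<in> carr A" if "j \<in> J" for j
      using that sb b by (auto simp: J_def e_def PiE_iff)
    then show "?f \<in> carr D" using pe s[OF b] by (auto simp: D_def direct_power_def)
  qed
  have Bne: "carr B \<noteq> {}" using sur Cne by auto
  have "subalg D (direct_power J A)"
    using cl onto Bne unfolding subalg_def by (auto simp: D_def)
  moreover have "(h \<circ> p) \<in> alg_hom D B"
    using h unfolding alg_hom_def by (auto simp: padd pmul) (auto simp: D_def)
  moreover have "(h \<circ> p) ` carr D = carr B"
  proof
    show "(h \<circ> p) ` carr D \<subseteq> carr B" using sur by (auto simp: D_def)
    show "carr B \<subseteq> (h \<circ> p) ` carr D"
    proof
      fix b assume b: "b \<in> carr B"
      obtain f where "f \<in> carr D" "p f = s b" using onto[OF b] by auto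
      then show "b \<in> (h \<circ> p) ` carr D" using s[OF b] by (auto intro!: image_eqI[of _ _ f])
    qed
  qed
  ultimately show ?thesis
    unfolding generated_variety_def image_of_subpower_def by blast
qed

definition power_semiring :: "'a::semigroup_mult set alg" where
  "power_semiring =
     \<lparr>carr = {U. U \<noteq> {}}, add = (\<union>), mul = (\<lambda>U V. {u * v | u v. u \<in> U \<and> v \<in> V})\<rparr>"

datatype s7 = S7_zero | S7_a | S7_one

instantiation s7 :: "{comm_monoid_mult, mult_zero}"
begin

definition "0 = S7_zero"
definition "1 = S7_one"
definition times_s7 :: "s7 \<Rightarrow> s7 \<Rightarrow> s7" where
  "x * y = (if x = S7_one then y else if y = S7_one then x else S7_zero)"

instance
  by standard (auto simp: times_s7_def zero_s7_def one_s7_def intro: s7.exhaust)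

end


section \<open>Words, terms and identities\<close>

text \<open>
  The variables are the natural numbers: \<open>0\<close> is the variable \<open>x\<close> and \<open>i \<ge> 1\<close> is the variable
  \<open>x\<^sub>i\<close>. Words are multisets of variables, the product of words being \<open>+\<close>; the empty word is
  \<open>{#}\<close>, which may not occur as a summand of a term.
\<close>

type_synonym word = "nat multiset"

definition term_alg :: "word set alg" where
  "term_alg =
     \<lparr>carr = {U. finite U \<and> U \<noteq> {} \<and> {#} \<notin> U}, add = (\<union>),
      mul = (\<lambda>U V. {u + v | u v. u \<in> U \<and> v \<in> V})\<rparr>"

text \<open>
  Evaluations of terms in \<open>S\<close> are the homomorphisms from the term algebra to \<open>S\<close>. For commutative
  ai-semirings \<open>S\<close> these correspond to the assignments of elements of \<open>S\<close> to the variables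
  (lemmas \<open>evaluation_exists\<close> and \<open>evaluation_unique\<close> below).
\<close>

definition satisfies_eq :: "'a alg \<Rightarrow> word set \<Rightarrow> word set \<Rightarrow> bool" where
  "satisfies_eq S u v \<longleftrightarrow> (\<forall>h\<in>alg_hom term_alg S. h u = h v)"

definition satisfies_le :: "'a alg \<Rightarrow> word set \<Rightarrow> word set \<Rightarrow> bool" where
  "satisfies_le S u v \<longleftrightarrow> satisfies_eq S v (v \<union> u)"

definition vars :: "word set \<Rightarrow> nat set" where
  "vars u = (\<Union>w\<in>u. set_mset w)"

definition sq :: "nat \<Rightarrow> word" where
  "sq i = {#i, i#}"

definition q :: "nat \<Rightarrow> nat \<Rightarrow> word" where
  "q n k = (\<Sum>i=1..k. {#i#}) + (\<Sum>i=k+1..n+1. sq i)"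

definition identity1 :: "'a alg \<Rightarrow> bool" where
  "identity1 S \<longleftrightarrow> satisfies_eq S {{#0, 0, 0#}} {{#0, 0#}}"

definition identity2 :: "'a alg \<Rightarrow> bool" where
  "identity2 S \<longleftrightarrow>
     (\<forall>n\<ge>1. \<forall>w :: nat \<Rightarrow> word.
        (\<forall>i\<in>{1..n+1}. set_mset (w i) \<subseteq> {1..n+1}) \<longrightarrow>
        satisfies_le S {\<Sum>i=1..n+1. sq i} ((\<lambda>i. sq i + w i) ` {1..n+1}))"

definition identity3 :: "'a alg \<Rightarrow> bool" where
  "identity3 S \<longleftrightarrow>
     (\<forall>n\<ge>1. \<forall>(w :: nat \<Rightarrow> word) (p :: nat \<Rightarrow> word).
        (\<forall>i\<in>{1..n+1}. set_mset (w i) \<subseteq> {1..n+1}) \<longrightarrow>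
        satisfies_le S {\<Sum>i=1..n+1. sq i}
          ((\<lambda>i. {#i#} + w i) ` {1..n+1} \<union> (\<lambda>i. sq i + p i) ` {1..n+1}))"

definition admissible :: "nat \<Rightarrow> nat \<Rightarrow> (nat \<Rightarrow> word) \<Rightarrow> bool" where
  "admissible n k w \<longleftrightarrow>
     (\<forall>i\<in>{1..k}. set_mset (w i) \<subseteq> {1..n+1} - {i}) \<and>
     (\<forall>i\<in>{k+1..n+1}. set_mset (w i) \<subseteq> {1..n+1}) \<and>
     vars {q n k} = vars ((\<lambda>i. {#i#} + w i) ` {1..n+1})"

definition identity4 :: "'a alg \<Rightarrow> bool" where
  "identity4 S \<longleftrightarrow>
     (\<forall>n\<ge>1. \<forall>k\<in>{1..n+1}. \<forall>(w :: nat \<Rightarrow> word) (p :: nat \<Rightarrow> word).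
        admissible n k w \<longrightarrow>
        satisfies_le S {q n k}
          ((\<lambda>i. {#i#} + w i) ` {1..n+1} \<union>
           (\<lambda>i. sq i + p i) ` {1..k-1} \<union>
           (\<lambda>i. sq i + p i) ` {k+1..n+1}))"

definition identity5 :: "'a alg \<Rightarrow> bool" where
  "identity5 S \<longleftrightarrow>
     (\<forall>n\<ge>1. \<forall>k\<in>{1..n+1}. \<forall>l<k-1.
      \<forall>(w :: nat \<Rightarrow> word) (p :: nat \<Rightarrow> word) (p' :: nat \<Rightarrow> nat \<Rightarrow> word).
        admissible n k w \<longrightarrow>
        satisfies_le S {q n k}
          ((\<lambda>i. {#i#} + w i) ` {1..n+1} \<union>
           (\<lambda>i. sq i + p i) ` {1..l} \<union>
           {{#i, j#} + p' i j | i j. l + 1 \<le> i \<and> i < j \<and> j \<le> k} \<union>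
           (\<lambda>i. sq i + p i) ` {k+1..n+1}))"


section \<open>Evaluations correspond to assignments\<close>

definition lift_op :: "'a set \<Rightarrow> ('a \<Rightarrow> 'a \<Rightarrow> 'a) \<Rightarrow> ('x \<Rightarrow> 'a) \<Rightarrow> 'x \<Rightarrow> 'a option \<Rightarrow> 'a option" where
  "lift_op C f v x r =
     (case r of None \<Rightarrow> Some (v x) | Some b \<Rightarrow> if b \<in> C then Some (f (v x) b) else Some b)"

lemma evaluation_exists:
  fixes S :: "'a alg"
  assumes S: "comm_ai_semiring S" and v: "range v \<subseteq> carr S"
  shows "\<exists>h\<in>alg_hom term_alg S. \<forall>i. h {{#i#}} = v i"
proof -
  let ?C = "carr S"
  note S' = S[unfolded comm_ai_semiring_def]
  have cl: "\<And>x y. x \<in> ?C \<Longrightarrow> y \<in> ?C \<Longrightarrow> x \<oplus>\<^bsub>S\<^esub> y \<in> ?C" "\<And>x y. x \<in> ?C \<Longrightarrow> y \<in> ?C \<Longrightarrow> x \<otimes>\<^bsub>S\<^esub> y \<in> ?C"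
    and aa: "\<And>x y z. x \<in> ?C \<Longrightarrow> y \<in> ?C \<Longrightarrow> z \<in> ?C \<Longrightarrow> (x \<oplus>\<^bsub>S\<^esub> y) \<oplus>\<^bsub>S\<^esub> z = x \<oplus>\<^bsub>S\<^esub> (y \<oplus>\<^bsub>S\<^esub> z)"
    and ac: "\<And>x y. x \<in> ?C \<Longrightarrow> y \<in> ?C \<Longrightarrow> x \<oplus>\<^bsub>S\<^esub> y = y \<oplus>\<^bsub>S\<^esub> x"
    and ai: "\<And>x. x \<in> ?C \<Longrightarrow> x \<oplus>\<^bsub>S\<^esub> x = x"
    and ma: "\<And>x y z. x \<in> ?C \<Longrightarrow> y \<in> ?C \<Longrightarrow> z \<in> ?C \<Longrightarrow> (x \<otimes>\<^bsub>S\<^esub> y) \<otimes>\<^bsub>S\<^esub> z = x \<otimes>\<^bsub>S\<^esub> (y \<otimes>\<^bsub>S\<^esub> z)"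
    and mc: "\<And>x y. x \<in> ?C \<Longrightarrow> y \<in> ?C \<Longrightarrow> x \<otimes>\<^bsub>S\<^esub> y = y \<otimes>\<^bsub>S\<^esub> x"
    and dl: "\<And>x y z. x \<in> ?C \<Longrightarrow> y \<in> ?C \<Longrightarrow> z \<in> ?C \<Longrightarrow> x \<otimes>\<^bsub>S\<^esub> (y \<oplus>\<^bsub>S\<^esub> z) = x \<otimes>\<^bsub>S\<^esub> y \<oplus>\<^bsub>S\<^esub> x \<otimes>\<^bsub>S\<^esub> z"
    and dr: "\<And>x y z. x \<in> ?C \<Longrightarrow> y \<in> ?C \<Longrightarrow> z \<in> ?C \<Longrightarrow> (x \<oplus>\<^bsub>S\<^esub> y) \<otimes>\<^bsub>S\<^esub> z = x \<otimes>\<^bsub>S\<^esub> z \<oplus>\<^bsub>S\<^esub> y \<otimes>\<^bsub>S\<^esub> z"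
    using S' by blast+
  have vC: "v i \<in> ?C" for i using v by auto
  have mlc: "x \<otimes>\<^bsub>S\<^esub> (y \<otimes>\<^bsub>S\<^esub> z) = y \<otimes>\<^bsub>S\<^esub> (x \<otimes>\<^bsub>S\<^esub> z)" if "x \<in> ?C" "y \<in> ?C" "z \<in> ?C" for x y z
    using that ma mc by metis
  have alc: "x \<oplus>\<^bsub>S\<^esub> (y \<oplus>\<^bsub>S\<^esub> z) = y \<oplus>\<^bsub>S\<^esub> (x \<oplus>\<^bsub>S\<^esub> z)" if "x \<in> ?C" "y \<in> ?C" "z \<in> ?C" for x y z
    using that aa ac by metis
  have ali: "x \<oplus>\<^bsub>S\<^esub> (x \<oplus>\<^bsub>S\<^esub> z) = x \<oplus>\<^bsub>S\<^esub> z" if "x \<in> ?C" "z \<in> ?C" for x z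
    using that aa ai by metis

  define F where "F = lift_op ?C (mul S) v"
  interpret F: comp_fun_commute F
    by standard (auto simp: F_def lift_op_def fun_eq_iff vC cl intro: mc mlc split: option.splits)
  have F0: "F i None = Some (v i)" and F1: "b \<in> ?C \<Longrightarrow> F i (Some b) = Some (v i \<otimes>\<^bsub>S\<^esub> b)" for i b
    by (simp_all add: F_def lift_op_def)
  define W where "W w = (if w = {#} then v 0 else the (fold_mset F None w))" for w
  have WF: "W w \<in> ?C \<and> (w \<noteq> {#} \<longrightarrow> fold_mset F None w = Some (W w))" for w
  proof (induction w)
    case empty then show ?case by (simp add: W_def vC)
  next
    case (add i w)
    show ?case
    proof (cases "w = {#}")
      case False
      then obtain b where "fold_mset F None w = Some b" "b \<in> ?C" using add.IH by auto
      then show ?thesis by (simp add: W_def F1 vC cl)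
    qed (simp add: W_def F0 vC)
  qed
  have W1: "W {#i#} = v i" for i by (simp add: W_def F0)
  have Wadd: "W (add_mset i w) = v i \<otimes>\<^bsub>S\<^esub> W w" if "w \<noteq> {#}" for i w
    using WF[of w] that by (simp add: W_def[of "add_mset i w"] F1)
  have WC: "W w \<in> ?C" for w using WF by blast
  have Wplus: "W (u + w) = W u \<otimes>\<^bsub>S\<^esub> W w" if "u \<noteq> {#}" "w \<noteq> {#}" for u w
    using that(1)
  proof (induction u)
    case (add i u)
    then show ?case
      using that(2) by (cases "u = {#}") (auto simp: W1 Wadd ma vC WC)
  qed simp

  define G where "G = lift_op ?C (add S) W"
  interpret G: comp_fun_idem G
    by standard (auto simp: G_def lift_op_def fun_eq_iff WC cl ai ali intro: ac alc split: option.splits)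
  have G0: "G i None = Some (W i)" and G1: "b \<in> ?C \<Longrightarrow> G i (Some b) = Some (W i \<oplus>\<^bsub>S\<^esub> b)" for i b
    by (simp_all add: G_def lift_op_def)
  define H where "H U = the (Finite_Set.fold G None U)" for U
  have HG: "Finite_Set.fold G None U = Some (H U) \<and> H U \<in> ?C" if "finite U" "U \<noteq> {}" for U
    using that
  proof (induction rule: finite_induct)
    case (insert u U)
    show ?case
    proof (cases "U = {}")
      case False
      then obtain b where "Finite_Set.fold G None U = Some b" "b \<in> ?C" using insert.IH by auto
      then show ?thesis using insert.hyps by (simp add: H_def G1 WC cl)
    qed (simp add: H_def G0 WC)
  qed simp
  have H1: "H {u} = W u" for u by (simp add: H_def G0)
  have Hins: "H (insert u U) = W u \<oplus>\<^bsub>S\<^esub> H U" if "finite U" "U \<noteq> {}" for u U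
  proof -
    have "Finite_Set.fold G None (insert u U) = G u (Finite_Set.fold G None U)"
      using that by simp
    also have "\<dots> = Some (W u \<oplus>\<^bsub>S\<^esub> H U)"
      using HG[OF that] by (simp add: G1)
    finally show ?thesis by (simp add: H_def)
  qed
  have HC: "H U \<in> ?C" if "finite U" "U \<noteq> {}" for U using HG that by blast
  have Hun: "H (U \<union> V) = H U \<oplus>\<^bsub>S\<^esub> H V" if "finite U" "U \<noteq> {}" "finite V" "V \<noteq> {}" for U V
    using that(1,2)
  proof (induction rule: finite_induct)
    case (insert u U)
    then show ?case
      using that(3,4) by (cases "U = {}") (auto simp: H1 Hins aa WC HC)
  qed simp
  have Hsg: "H ((\<lambda>w. u + w) ` V) = W u \<otimes>\<^bsub>S\<^esub> H V"
    if "finite V" "V \<noteq> {}" "{#} \<notin> V" "u \<noteq> {#}" for u V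
    using that(1-3)
  proof (induction rule: finite_induct)
    case (insert w V)
    then show ?case
      using that(4) by (cases "V = {}") (auto simp: H1 Hins Wplus dl WC HC)
  qed simp
  have Hmul: "H {u + w | u w. u \<in> U \<and> w \<in> V} = H U \<otimes>\<^bsub>S\<^esub> H V"
    if V: "finite V" "V \<noteq> {}" "{#} \<notin> V" and "finite U" "U \<noteq> {}" "{#} \<notin> U" for U V
    using that(4-6)
  proof (induction rule: finite_induct)
    case (insert x U)
    have eq: "{u + w | u w. u \<in> insert x U \<and> w \<in> V}
        = (\<lambda>w. x + w) ` V \<union> {u + w | u w. u \<in> U \<and> w \<in> V}" by auto
    show ?case
    proof (cases "U = {}")
      case True
      then have "{u + w | u w. u \<in> insert x U \<and> w \<in> V} = (\<lambda>w. x + w) ` V" by auto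
      then show ?thesis using Hsg[OF V, of x] insert.prems True by (simp only:) (simp add: H1)
    next
      case False
      have fin: "finite {u + w | u w. u \<in> U \<and> w \<in> V}"
        using insert.hyps(1) V(1) by (rule finite_image_set2[of "\<lambda>u. u \<in> U" "\<lambda>w. w \<in> V", simplified])
      have ne: "{u + w | u w. u \<in> U \<and> w \<in> V} \<noteq> {}" using False V(2) by blast
      show ?thesis
        unfolding eq using insert False V
        by (subst Hun) (auto simp: fin ne Hsg Hins dr WC HC simp del: Collect_empty_eq)
    qed
  qed simp
  have "H \<in> alg_hom term_alg S"
    unfolding alg_hom_def term_alg_def by (auto simp: HC Hun Hmul)
  then show ?thesis by (intro bexI[of _ H]) (simp_all add: H1 W1)
qed

lemma evaluation_unique:
  fixes S :: "'a alg"
  assumes g: "g \<in> alg_hom term_alg S" and h: "h \<in> alg_hom term_alg S"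
    and eq: "\<And>i. g {{#i#}} = h {{#i#}}" and U: "U \<in> carr term_alg"
  shows "g U = h U"
proof -
  have hom: "f (X \<union> Y) = f X \<oplus>\<^bsub>S\<^esub> f Y" "f {a + b | a b. a \<in> X \<and> b \<in> Y} = f X \<otimes>\<^bsub>S\<^esub> f Y"
    if "f \<in> alg_hom term_alg S" "X \<in> carr term_alg" "Y \<in> carr term_alg" for f X Y
    using that unfolding alg_hom_def term_alg_def by auto
  have word: "g {w} = h {w}" if "w \<noteq> {#}" for w
    using that
  proof (induction w)
    case (add i w)
    show ?case
    proof (cases "w = {#}")
      case False
      have t: "{{#i#}} \<in> carr term_alg" "{w} \<in> carr term_alg"
        using False by (auto simp: term_alg_def)
      show ?thesis
        using hom(2)[OF g t] hom(2)[OF h t] add.IH[OF False] eq by simp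
    qed (simp add: eq)
  qed simp
  have "finite U" "U \<noteq> {}" "{#} \<notin> U" using U by (auto simp: term_alg_def)
  then show ?thesis
  proof (induction rule: finite_induct)
    case (insert w U)
    show ?case
    proof (cases "U = {}")
      case False
      have t: "{w} \<in> carr term_alg" "U \<in> carr term_alg"
        using False insert by (auto simp: term_alg_def)
      show ?thesis
        using hom(1)[OF g t] hom(1)[OF h t] insert False word[of w] by simp
    qed (use insert word in auto)
  qed simp
qed

end

theory Submission
  imports Defs
begin

text \<open>
  By Birkhoff's theorem it suffices to show that the identities of the power semiring \<open>P\<close> follow
  from (1)--(5), and that \<open>P\<close> satisfies these. An identity \<open>u \<approx> v\<close> amounts to the inequalities
  \<open>w \<preceq> v\<close> for the words \<open>w\<close> of \<open>u\<close> and the symmetric ones. Testing when \<open>1\<close>, \<open>a\<close> and \<open>0\<close> lie in the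
  value of a word turns the validity of \<open>w \<preceq> v\<close> in \<open>P\<close> into a combinatorial condition:
  every variable of \<open>w\<close> occurs in a summand of \<open>v\<close> all of whose variables occur in \<open>w\<close> (and linearly,
  if it is linear in \<open>w\<close>), the square of every nonlinear variable of \<open>w\<close> divides a summand, and for any
  two variables \<open>x\<close>, \<open>y\<close> of \<open>w\<close> one of \<open>x\<^sup>2\<close>, \<open>y\<^sup>2\<close>, \<open>x y\<close> divides a summand. The summands so obtained
  are those on the right of (3) if \<open>w\<close> has no linear variable, of (4) if the squares of all linear
  variables but at most one divide summands, and of (5) otherwise. Identity (2) is an instance of (3).
\<close>

section \<open>Term algebra and evaluations\<close>

lemma carr_term_alg: "U \<in> carr term_alg \<longleftrightarrow> finite U \<and> U \<noteq> {} \<and> {#} \<notin> U"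
  by (simp add: term_alg_def)

lemma Un_in_carr_term_alg:
  "U \<in> carr term_alg \<Longrightarrow> V \<in> carr term_alg \<Longrightarrow> U \<union> V \<in> carr term_alg"
  by (auto simp: carr_term_alg)

lemma mul_in_carr_term_alg:
  assumes "U \<in> carr term_alg" "V \<in> carr term_alg"
  shows "{u + w | u w. u \<in> U \<and> w \<in> V} \<in> carr term_alg"
proof -
  have "{u + w | u w. u \<in> U \<and> w \<in> V} = (\<lambda>(u, w). u + w) ` (U \<times> V)" by auto
  then show ?thesis using assms by (auto simp: carr_term_alg)
qed

lemma hom_closed: "h \<in> alg_hom A B \<Longrightarrow> x \<in> carr A \<Longrightarrow> h x \<in> carr B"
  by (auto simp: alg_hom_def)

lemma hom_Un:
  "h \<in> alg_hom term_alg S \<Longrightarrow> U \<in> carr term_alg \<Longrightarrow> V \<in> carr term_alg \<Longrightarrow>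
    h (U \<union> V) = h U \<oplus>\<^bsub>S\<^esub> h V"
  by (auto simp: alg_hom_def term_alg_def)

lemma hom_mul:
  "h \<in> alg_hom term_alg S \<Longrightarrow> U \<in> carr term_alg \<Longrightarrow> V \<in> carr term_alg \<Longrightarrow>
    h {u + w | u w. u \<in> U \<and> w \<in> V} = h U \<otimes>\<^bsub>S\<^esub> h V"
  by (auto simp: alg_hom_def term_alg_def)

lemma hom_word_plus:
  assumes "h \<in> alg_hom term_alg S" "u \<noteq> {#}" "w \<noteq> {#}"
  shows "h {u + w} = h {u} \<otimes>\<^bsub>S\<^esub> h {w}"
  using hom_mul[OF assms(1), of "{u}" "{w}"] assms(2,3) by (simp add: carr_term_alg)

lemma hom_comp:
  "g \<in> alg_hom A B \<Longrightarrow> h \<in> alg_hom B C \<Longrightarrow> h \<circ> g \<in> alg_hom A C"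
  by (auto simp: alg_hom_def Pi_iff)

lemma hom_term_algI:
  assumes "\<And>U. U \<in> carr term_alg \<Longrightarrow> h U \<in> carr S"
    and "\<And>U V. U \<in> carr term_alg \<Longrightarrow> V \<in> carr term_alg \<Longrightarrow> h (U \<union> V) = h U \<oplus>\<^bsub>S\<^esub> h V"
    and "\<And>U V. U \<in> carr term_alg \<Longrightarrow> V \<in> carr term_alg \<Longrightarrow>
      h {u + w | u w. u \<in> U \<and> w \<in> V} = h U \<otimes>\<^bsub>S\<^esub> h V"
  shows "h \<in> alg_hom term_alg S"
  unfolding alg_hom_def using assms by (auto simp: term_alg_def)

section \<open>Substitution of variables for variables\<close>

definition rename :: "(nat \<Rightarrow> nat) \<Rightarrow> word set \<Rightarrow> word set" where
  "rename f U = image_mset f ` U"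

lemma rename_carrI: "U \<in> carr term_alg \<Longrightarrow> rename f U \<in> carr term_alg"
  by (auto simp: rename_def carr_term_alg)

lemma rename_Un: "rename f (U \<union> V) = rename f U \<union> rename f V"
  by (auto simp: rename_def)

lemma rename_mul:
  "rename f {u + w | u w. u \<in> U \<and> w \<in> V} = {u + w | u w. u \<in> rename f U \<and> w \<in> rename f V}"
proof -
  have "{u + w | u w. u \<in> U \<and> w \<in> V} = (\<Union>u\<in>U. (\<lambda>w. u + w) ` V)" for U V :: "word set"
    by auto
  then show ?thesis by (simp add: rename_def image_UN image_image)
qed

text \<open>Precomposing an evaluation with a renaming gives an evaluation. This is how an identity
  valid in \<open>S\<close> gets instantiated; renamings are the only substitutions used, because
  the cofactors in (2)--(5) already range over words.\<close>

lemma hom_rename: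
  assumes "h \<in> alg_hom term_alg S"
  shows "(\<lambda>U. h (rename f U)) \<in> alg_hom term_alg S"
proof (rule hom_term_algI)
  fix U V assume "U \<in> carr term_alg" "V \<in> carr term_alg"
  then show "h (rename f {u + w | u w. u \<in> U \<and> w \<in> V}) = h (rename f U) \<otimes>\<^bsub>S\<^esub> h (rename f V)"
    unfolding rename_mul by (rule hom_mul[OF assms rename_carrI rename_carrI])
qed (auto simp: rename_Un intro: hom_closed[OF assms] hom_Un[OF assms] rename_carrI)

text \<open>Chosen by \<open>SOME\<close> to have a function of the assignment. By
  \<open>evaluation_unique\<close> the choice is unambiguous on \<open>carr term_alg\<close>, the
  only place where its values matter.\<close>

definition evaluation :: "'a alg \<Rightarrow> (nat \<Rightarrow> 'a) \<Rightarrow> word set \<Rightarrow> 'a" where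
  "evaluation S v = (SOME h. h \<in> alg_hom term_alg S \<and> (\<forall>i. h {{#i#}} = v i))"

lemma evaluation_hom:
  assumes "comm_ai_semiring S" "range v \<subseteq> carr S"
  shows "evaluation S v \<in> alg_hom term_alg S" "evaluation S v {{#i#}} = v i"
proof -
  have "\<exists>h. h \<in> alg_hom term_alg S \<and> (\<forall>i. h {{#i#}} = v i)"
    using evaluation_exists[OF assms] by blast
  then have "evaluation S v \<in> alg_hom term_alg S \<and> (\<forall>i. evaluation S v {{#i#}} = v i)"
    unfolding evaluation_def by (rule someI_ex)
  then show "evaluation S v \<in> alg_hom term_alg S" "evaluation S v {{#i#}} = v i" by auto
qed

lemma hom_eq_evaluation:
  assumes S: "comm_ai_semiring S" and v: "range v \<subseteq> carr S" and h: "h \<in> alg_hom term_alg S"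
    and eq: "\<And>i. h {{#i#}} = v i" and U: "U \<in> carr term_alg"
  shows "h U = evaluation S v U"
  by (rule evaluation_unique[OF h evaluation_hom(1)[OF S v] _ U])
    (simp only: eq evaluation_hom(2)[OF S v])

lemma evaluation_rename:
  assumes S: "comm_ai_semiring S" and v: "range v \<subseteq> carr S" and U: "U \<in> carr term_alg"
  shows "evaluation S v (rename f U) = evaluation S (v \<circ> f) U"
proof (rule hom_eq_evaluation[OF S _ hom_rename[OF evaluation_hom(1)[OF S v]] _ U])
  show "range (v \<circ> f) \<subseteq> carr S" using v by auto
  show "evaluation S v (rename f {{#i#}}) = (v \<circ> f) i" for i
    by (simp add: rename_def evaluation_hom(2)[OF S v])
qed

text \<open>On terms, every homomorphism is the evaluation of its own restriction to the variables,
  so testing assignments is enough.\<close>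

lemma satisfies_eqI_evaluation:
  assumes "comm_ai_semiring S" "u \<in> carr term_alg" "v \<in> carr term_alg"
    and "\<And>\<nu>. range \<nu> \<subseteq> carr S \<Longrightarrow> evaluation S \<nu> u = evaluation S \<nu> v"
  shows "satisfies_eq S u v"
  unfolding satisfies_eq_def
proof
  fix h assume h: "h \<in> alg_hom term_alg S"
  have r: "range (\<lambda>i. h {{#i#}}) \<subseteq> carr S"
    using hom_closed[OF h, of "{{#_#}}"] by (auto simp: carr_term_alg)
  have "h U = evaluation S (\<lambda>i. h {{#i#}}) U" if "U \<in> carr term_alg" for U
    by (rule hom_eq_evaluation[OF assms(1) r h refl that])
  from this[OF assms(2)] this[OF assms(3)] assms(4)[OF r] show "h u = h v" by (simp only:)
qed

section \<open>Birkhoff's theorem\<close>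

lemma comm_ai_semiring_direct_power:
  assumes A: "comm_ai_semiring A"
  shows "comm_ai_semiring (direct_power I A)" (is "comm_ai_semiring ?P")
proof -
  note A' = A[unfolded comm_ai_semiring_def]
  obtain a where "a \<in> carr A" using A' by auto
  then have "(\<lambda>i\<in>I. a) \<in> I \<rightarrow>\<^sub>E carr A" by auto
  then have ne: "carr ?P \<noteq> {}" unfolding direct_power_def alg.simps by blast
  have mem: "f i \<in> carr A" if "f \<in> carr ?P" "i \<in> I" for f i
    using that by (auto simp: direct_power_def)
  have at: "(f \<oplus>\<^bsub>?P\<^esub> g) i = f i \<oplus>\<^bsub>A\<^esub> g i" "(f \<otimes>\<^bsub>?P\<^esub> g) i = f i \<otimes>\<^bsub>A\<^esub> g i" if "i \<in> I" for f g i
    using that by (auto simp: direct_power_def)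
  have closed: "f \<oplus>\<^bsub>?P\<^esub> g \<in> carr ?P" "f \<otimes>\<^bsub>?P\<^esub> g \<in> carr ?P" if "f \<in> carr ?P" "g \<in> carr ?P" for f g
    using that A' by (auto simp: direct_power_def)
  have eqI: "f = g" if "f \<in> carr ?P" "g \<in> carr ?P" "\<And>i. i \<in> I \<Longrightarrow> f i = g i" for f g
    using that by (auto simp: direct_power_def intro: PiE_ext)
  show ?thesis
    unfolding comm_ai_semiring_def using A'
    by (elim conjE, intro conjI ballI)
      (rule ne closed eqI; (intro closed | simp only: at); (assumption | blast intro: mem))+
qed

lemma comm_ai_semiring_subalg:
  "subalg C A \<Longrightarrow> comm_ai_semiring A \<Longrightarrow> comm_ai_semiring C"
  unfolding comm_ai_semiring_def subalg_def subset_iff by (elim conjE, intro conjI) (blast | simp)+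

lemma comm_ai_semiring_hom_image:
  assumes C: "comm_ai_semiring C" and h: "h \<in> alg_hom C B" and sur: "h ` carr C = carr B"
  shows "comm_ai_semiring B"
proof -
  have hom: "h x \<oplus>\<^bsub>B\<^esub> h y = h (x \<oplus>\<^bsub>C\<^esub> y)" "h x \<otimes>\<^bsub>B\<^esub> h y = h (x \<otimes>\<^bsub>C\<^esub> y)"
    if "x \<in> carr C" "y \<in> carr C" for x y
    using h that by (auto simp: alg_hom_def)
  show ?thesis
    using C unfolding comm_ai_semiring_def sur[symmetric]
    by (elim conjE, intro conjI) (simp add: hom | blast)+
qed

text \<open>Identities pass to a subalgebra of a power because each coordinate is a homomorphism to
  \<open>A\<close>, and to its image because evaluations lift along surjections.\<close>

lemma satisfies_eq_generated_variety:
  fixes A :: "'a alg" and B :: "'b alg"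
  assumes A: "comm_ai_semiring A" and B: "B \<in> generated_variety A"
    and u: "u \<in> carr term_alg" and v: "v \<in> carr term_alg" and eq: "satisfies_eq A u v"
  shows "satisfies_eq B u v"
proof -
  obtain I :: "('b \<Rightarrow> 'a) set" and C h where C: "subalg C (direct_power I A)" and h: "h \<in> alg_hom C B"
    and sur: "h ` carr C = carr B"
    using B unfolding generated_variety_def image_of_subpower_def by blast
  have Cs: "comm_ai_semiring C"
    using comm_ai_semiring_subalg[OF C comm_ai_semiring_direct_power[OF A]] .
  have C_eq: "g u = g v" if g: "g \<in> alg_hom term_alg C" for g
  proof
    fix i
    have sub: "carr C \<subseteq> (I \<rightarrow>\<^sub>E carr A)" and ops: "add C = add (direct_power I A)" "mul C = mul (direct_power I A)"
      using C by (auto simp: subalg_def direct_power_def)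
    show "g u i = g v i"
    proof (cases "i \<in> I")
      case True
      have "x i \<in> carr A" if "x \<in> carr C" for x using that sub True by auto
      then have "(\<lambda>x. x i) \<in> alg_hom C A"
        using True by (simp add: alg_hom_def ops direct_power_def)
      then have "(\<lambda>x. x i) \<circ> g \<in> alg_hom term_alg A" using g by (rule hom_comp[rotated])
      then have "((\<lambda>x. x i) \<circ> g) u = ((\<lambda>x. x i) \<circ> g) v"
        using eq unfolding satisfies_eq_def by blast
      then show ?thesis by simp
    next
      case False
      \<comment> \<open>Outside \<open>I\<close> both functions are \<open>undefined\<close> by
        extensionality.\<close>
      then show ?thesis using hom_closed[OF g u] hom_closed[OF g v] sub False PiE_arb[of _ I "\<lambda>_. carr A" i] by (metis subsetD)
    qed
  qed
  show ?thesis
    unfolding satisfies_eq_def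
  proof
    fix k assume k: "k \<in> alg_hom term_alg B"
    \<comment> \<open>The lift of \<open>k\<close> evaluates at chosen preimages \<open>c i\<close>
      of the values of the variables; its composite with \<open>h\<close> agrees with
      \<open>k\<close> on variables, hence on terms.\<close>
    have "k {{#i#}} \<in> h ` carr C" for i
      unfolding sur by (rule hom_closed[OF k]) (simp add: carr_term_alg)
    then have "\<exists>c\<in>carr C. h c = k {{#i#}}" for i by (metis imageE)
    then obtain c where c: "\<And>i. c i \<in> carr C" "\<And>i. h (c i) = k {{#i#}}" by metis
    have r: "range c \<subseteq> carr C" using c by auto
    have g: "evaluation C c \<in> alg_hom term_alg C" using evaluation_hom(1)[OF Cs r] .
    have "(h \<circ> evaluation C c) U = k U" if "U \<in> carr term_alg" for U
      by (rule evaluation_unique[OF hom_comp[OF g h] k _ that])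
        (simp add: evaluation_hom(2)[OF Cs r] c(2))
    then show "k u = k v" using C_eq[OF g] u v by (metis comp_apply)
  qed
qed

lemma comm_ai_semiring_generated_variety:
  fixes A :: "'a alg" and B :: "'b alg"
  assumes A: "comm_ai_semiring A" and B: "B \<in> generated_variety A"
  shows "comm_ai_semiring B"
proof -
  obtain I :: "('b \<Rightarrow> 'a) set" and C h where C: "subalg C (direct_power I A)"
    and h: "h \<in> alg_hom C B" "h ` carr C = carr B"
    using B unfolding generated_variety_def image_of_subpower_def by blast
  show ?thesis
    by (rule comm_ai_semiring_hom_image[OF comm_ai_semiring_subalg[OF C comm_ai_semiring_direct_power[OF A]] h])
qed

text \<open>The algebra \<open>C\<close> below is the relatively free algebra on the elements of
  \<open>S\<close>, realised inside the power of \<open>A\<close> over all maps \<phi> from elements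
  to \<open>A\<close>: the generator \<open>b\<close> is the function that sends \<phi> to its value
  at \<open>b\<close>. The generators evaluate to themselves in \<open>S\<close>, and the assumed
  identities make this extend to a homomorphism onto \<open>S\<close>.\<close>

lemma in_generated_varietyI:
  fixes A :: "'a alg" and S :: "'b alg"
  assumes A: "comm_ai_semiring A" and S: "comm_ai_semiring S"
    and ids: "\<And>u v. u \<in> carr term_alg \<Longrightarrow> v \<in> carr term_alg \<Longrightarrow> satisfies_eq A u v \<Longrightarrow> satisfies_eq S u v"
  shows "S \<in> generated_variety A"
proof -
  define I :: "('b \<Rightarrow> 'a) set" where "I = {\<phi>. range \<phi> \<subseteq> carr A}"
  \<comment> \<open>\<open>val v U\<close> is the term \<open>U\<close> computed in the power with
    the variable \<open>i\<close> read as the generator \<open>v i\<close>.\<close>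
  define val where "val v U = (\<lambda>\<phi>\<in>I. evaluation A (\<phi> \<circ> v) U)" for v :: "nat \<Rightarrow> 'b" and U
  have rA: "range (\<phi> \<circ> v) \<subseteq> carr A" if "\<phi> \<in> I" for \<phi> v using that by (auto simp: I_def)
  have val_rename: "val v (rename f U) = val (v \<circ> f) U" if "U \<in> carr term_alg" for v f U
    unfolding val_def
  proof (rule restrict_ext)
    fix \<phi> assume "\<phi> \<in> I"
    show "evaluation A (\<phi> \<circ> v) (rename f U) = evaluation A (\<phi> \<circ> (v \<circ> f)) U"
      unfolding evaluation_rename[OF A rA[OF \<open>\<phi> \<in> I\<close>] that] comp_assoc ..
  qed
  have same: "evaluation S v U = evaluation S v V"
    if v: "range v \<subseteq> carr S" and U: "U \<in> carr term_alg" and V: "V \<in> carr term_alg"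
      and eq: "val v U = val v V" for v U V
  proof -
    \<comment> \<open>Equality of the two \<open>val\<close>s tests only assignments that agree on
      variables with the same value under \<open>v\<close>. Merging such variables by
      \<open>r\<close> turns it into an identity of \<open>A\<close>: every assignment precomposed
      with \<open>r\<close> factors through \<open>v\<close>.\<close>
    define r where "r i = (LEAST j. v j = v i)" for i
    have "v (r i) = v i" for i unfolding r_def by (rule LeastI[of _ i]) simp
    then have vr: "v \<circ> r = v" by (simp add: fun_eq_iff)
    have "satisfies_eq A (rename r U) (rename r V)"
    proof (rule satisfies_eqI_evaluation[OF A rename_carrI[OF U] rename_carrI[OF V]])
      fix \<nu> :: "nat \<Rightarrow> 'a" assume \<nu>: "range \<nu> \<subseteq> carr A"
      define \<phi> where "\<phi> b = \<nu> (LEAST j. v j = b)" for b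
      have "\<phi> \<in> I" using \<nu> unfolding I_def \<phi>_def by blast
      moreover have "\<phi> \<circ> v = \<nu> \<circ> r" by (auto simp: \<phi>_def r_def)
      ultimately have "evaluation A (\<nu> \<circ> r) U = evaluation A (\<nu> \<circ> r) V"
        using fun_cong[OF eq, of \<phi>] by (simp add: val_def)
      then show "evaluation A \<nu> (rename r U) = evaluation A \<nu> (rename r V)"
        by (simp add: evaluation_rename[OF A \<nu>] U V)
    qed
    then have "satisfies_eq S (rename r U) (rename r V)"
      by (rule ids[OF rename_carrI[OF U] rename_carrI[OF V]])
    then have "evaluation S v (rename r U) = evaluation S v (rename r V)"
      using evaluation_hom(1)[OF S v] by (auto simp: satisfies_eq_def)
    then show ?thesis by (simp add: evaluation_rename[OF S v] U V vr)
  qed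
  have common: "\<exists>w U' V'. range w \<subseteq> carr S \<and> U' \<in> carr term_alg \<and> V' \<in> carr term_alg \<and>
      val v U = val w U' \<and> val v' V = val w V' \<and>
      evaluation S v U = evaluation S w U' \<and> evaluation S v' V = evaluation S w V'"
    if v: "range v \<subseteq> carr S" "range v' \<subseteq> carr S" and U: "U \<in> carr term_alg" and V: "V \<in> carr term_alg"
    for v v' U V
  proof -
    \<comment> \<open>Two elements of \<open>C\<close> may come with different assignments.
      Interleaving these on even and odd variables expresses both elements over one assignment
      \<open>w\<close>.\<close>
    define w where "w i = (if even i then v (i div 2) else v' (i div 2))" for i :: nat
    have w: "range w \<subseteq> carr S" using v by (auto simp: w_def)
    have eqs: "w \<circ> (\<lambda>i. 2 * i) = v" "w \<circ> (\<lambda>i. 2 * i + 1) = v'" by (auto simp: w_def)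
    let ?U = "rename (\<lambda>i. 2 * i) U" and ?V = "rename (\<lambda>i. 2 * i + 1) V"
    have "val v U = val w ?U" "val v' V = val w ?V"
      "evaluation S v U = evaluation S w ?U" "evaluation S v' V = evaluation S w ?V"
      unfolding val_rename[OF U] val_rename[OF V] evaluation_rename[OF S w U]
        evaluation_rename[OF S w V] eqs by (rule refl)+
    then show ?thesis using w rename_carrI[OF U] rename_carrI[OF V] by blast
  qed
  define C where "C = \<lparr>carr = {val v U | v U. range v \<subseteq> carr S \<and> U \<in> carr term_alg},
     add = add (direct_power I A), mul = mul (direct_power I A)\<rparr>"
  have val_add: "val v U \<oplus>\<^bsub>C\<^esub> val v V = val v (U \<union> V)"
    if "U \<in> carr term_alg" "V \<in> carr term_alg" for v U V
    unfolding C_def direct_power_def val_def fun_eq_iff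
    using hom_Un[OF evaluation_hom(1)[OF A rA] that] by simp
  have val_mul: "val v U \<otimes>\<^bsub>C\<^esub> val v V = val v {u + w | u w. u \<in> U \<and> w \<in> V}"
    if "U \<in> carr term_alg" "V \<in> carr term_alg" for v U V
    unfolding C_def direct_power_def val_def fun_eq_iff
    using hom_mul[OF evaluation_hom(1)[OF A rA] that] by simp
  define h where "h c = (SOME b. \<exists>v U. range v \<subseteq> carr S \<and> U \<in> carr term_alg \<and> c = val v U \<and>
     b = evaluation S v U)" for c
  have h_val: "h (val v U) = evaluation S v U" if v: "range v \<subseteq> carr S" and U: "U \<in> carr term_alg" for v U
    unfolding h_def
  proof (rule some_equality)
    show "\<exists>va Ua. range va \<subseteq> carr S \<and> Ua \<in> carr term_alg \<and> val v U = val va Ua \<and>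
        evaluation S v U = evaluation S va Ua" using that by blast
    fix b
    assume "\<exists>va Ua. range va \<subseteq> carr S \<and> Ua \<in> carr term_alg \<and> val v U = val va Ua \<and> b = evaluation S va Ua"
    then obtain v' V where V: "range v' \<subseteq> carr S" "V \<in> carr term_alg" "val v U = val v' V"
      "b = evaluation S v' V" by blast
    \<comment> \<open>Well-definedness: over a common assignment the two terms have the same
      \<open>val\<close>, so \<open>same\<close> gives the same value in \<open>S\<close>.\<close>
    show "b = evaluation S v U"
      using common[OF v V(1) U V(2)] same V(3,4) by metis
  qed
  have ops: "x \<oplus>\<^bsub>C\<^esub> y \<in> carr C \<and> x \<otimes>\<^bsub>C\<^esub> y \<in> carr C \<and>
      h (x \<oplus>\<^bsub>C\<^esub> y) = h x \<oplus>\<^bsub>S\<^esub> h y \<and> h (x \<otimes>\<^bsub>C\<^esub> y) = h x \<otimes>\<^bsub>S\<^esub> h y"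
    if x: "x \<in> carr C" and y: "y \<in> carr C" for x y
  proof -
    obtain v U v' V where "range v \<subseteq> carr S" "range v' \<subseteq> carr S" "U \<in> carr term_alg" "V \<in> carr term_alg"
      and xy: "x = val v U" "y = val v' V" using x y unfolding C_def by fastforce
    from common[OF this(1-4)] obtain w U V where w: "range w \<subseteq> carr S"
      and U: "U \<in> carr term_alg" and V: "V \<in> carr term_alg"
      and xy: "x = val w U" "y = val w V" unfolding xy by blast
    note UV = Un_in_carr_term_alg[OF U V] mul_in_carr_term_alg[OF U V]
    have "x \<oplus>\<^bsub>C\<^esub> y \<in> carr C" "x \<otimes>\<^bsub>C\<^esub> y \<in> carr C"
      unfolding xy val_add[OF U V] val_mul[OF U V] using w UV unfolding C_def by auto
    moreover have "h (x \<oplus>\<^bsub>C\<^esub> y) = h x \<oplus>\<^bsub>S\<^esub> h y"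
      unfolding xy val_add[OF U V] h_val[OF w UV(1)] h_val[OF w U] h_val[OF w V]
      by (rule hom_Un[OF evaluation_hom(1)[OF S w] U V])
    moreover have "h (x \<otimes>\<^bsub>C\<^esub> y) = h x \<otimes>\<^bsub>S\<^esub> h y"
      unfolding xy val_mul[OF U V] h_val[OF w UV(2)] h_val[OF w U] h_val[OF w V]
      by (rule hom_mul[OF evaluation_hom(1)[OF S w] U V])
    ultimately show ?thesis by blast
  qed
  have onto: "b \<in> h ` carr C" if "b \<in> carr S" for b
  proof -
    have r: "range (\<lambda>_::nat. b) \<subseteq> carr S" using that by auto
    have t: "{{#0#}} \<in> carr term_alg" by (simp add: carr_term_alg)
    have "h (val (\<lambda>_. b) {{#0#}}) = b"
      using h_val[OF r t] evaluation_hom(2)[OF S r] by simp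
    moreover have "val (\<lambda>_. b) {{#0#}} \<in> carr C" using r t unfolding C_def by auto
    ultimately show ?thesis by (metis imageI)
  qed
  have closed: "h x \<in> carr S" if x: "x \<in> carr C" for x
  proof -
    obtain v U where "range v \<subseteq> carr S" "U \<in> carr term_alg" "x = val v U"
      using x unfolding C_def by fastforce
    then show ?thesis using h_val hom_closed[OF evaluation_hom(1)[OF S]] by metis
  qed
  have "subalg C (direct_power I A)"
    unfolding subalg_def
  proof (intro conjI)
    have "carr S \<noteq> {}" using S by (simp add: comm_ai_semiring_def)
    then show "carr C \<noteq> {}" using onto by auto
    show "carr C \<subseteq> carr (direct_power I A)"
      using hom_closed[OF evaluation_hom(1)[OF A rA]] by (auto simp: C_def direct_power_def val_def)
    show "add C = add (direct_power I A)" "mul C = mul (direct_power I A)"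
      by (simp_all add: C_def)
    show "\<forall>x\<in>carr C. \<forall>y\<in>carr C. x \<oplus>\<^bsub>C\<^esub> y \<in> carr C \<and> x \<otimes>\<^bsub>C\<^esub> y \<in> carr C"
      using ops by blast
  qed
  moreover have "h \<in> alg_hom C S" unfolding alg_hom_def using ops closed by blast
  moreover have "h ` carr C = carr S" using onto closed by blast
  ultimately show ?thesis
    by (intro generated_varietyI[of I]) (auto simp: image_of_subpower_def)
qed

section \<open>Inequalities valid in the power semiring\<close>

definition twice_covered :: "nat \<Rightarrow> word set \<Rightarrow> bool" where
  "twice_covered x v \<longleftrightarrow> (\<exists>u\<in>v. 2 \<le> count u x)"

text \<open>The three conditions say that \<open>v\<close> can attain the value \<open>a\<close> whenever \<open>w\<close> can, and the value
  \<open>0\<close> whenever \<open>w\<close> can because of one squared variable, or because of two variables, valued \<open>a\<close>.\<close>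

definition covers :: "word set \<Rightarrow> word \<Rightarrow> bool" where
  "covers v w \<longleftrightarrow>
     (\<forall>x\<in>#w. \<exists>u\<in>v. set_mset u \<subseteq> set_mset w \<and> x \<in># u \<and> (count w x = 1 \<longrightarrow> count u x = 1)) \<and>
     (\<forall>x. 2 \<le> count w x \<longrightarrow> twice_covered x v) \<and>
     (\<forall>x\<in>#w. \<forall>y\<in>#w. x \<noteq> y \<longrightarrow>
        twice_covered x v \<or> twice_covered y v \<or> (\<exists>u\<in>v. x \<in># u \<and> y \<in># u))"

abbreviation (input) P7 :: "s7 set alg" where "P7 \<equiv> power_semiring"

lemma comm_ai_semiring_P7: "comm_ai_semiring P7"
proof -
  have ne: "{u * v |u v. u \<in> U \<and> v \<in> V} \<noteq> {}" if "U \<noteq> {}" "V \<noteq> {}" for U V :: "s7 set"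
    using that by blast
  have assoc: "{u * v |u v. u \<in> {u * v |u v. u \<in> U \<and> v \<in> V} \<and> v \<in> W}
      = {u * v |u v. u \<in> U \<and> v \<in> {u * v |u v. u \<in> V \<and> v \<in> W}}" for U V W :: "s7 set"
  proof -
    have mul: "{u * v |u v. u \<in> U \<and> v \<in> V} = (\<Union>u\<in>U. (\<lambda>v. u * v) ` V)" for U V :: "s7 set"
      by auto
    show ?thesis unfolding mul image_UN image_image UN_UN_flatten mult.assoc by blast
  qed
  have comm_sub: "{u * v |u v. u \<in> U \<and> v \<in> V} \<subseteq> {u * v |u v. u \<in> V \<and> v \<in> U}" for U V :: "s7 set"
  proof clarify
    fix u v assume "u \<in> U" "v \<in> V"
    then show "\<exists>u' v'. u * v = u' * v' \<and> u' \<in> V \<and> v' \<in> U" using mult.commute[of u v] by blast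
  qed
  have comm: "{u * v |u v. u \<in> U \<and> v \<in> V} = {u * v |u v. u \<in> V \<and> v \<in> U}" for U V :: "s7 set"
    by (rule equalityI[OF comm_sub comm_sub])
  have dist: "{u * v |u v. u \<in> U \<and> v \<in> V \<union> W} = {u * v |u v. u \<in> U \<and> v \<in> V} \<union> {u * v |u v. u \<in> U \<and> v \<in> W}"
    "{u * v |u v. u \<in> U \<union> V \<and> v \<in> W} = {u * v |u v. u \<in> U \<and> v \<in> W} \<union> {u * v |u v. u \<in> V \<and> v \<in> W}"
    for U V W :: "s7 set"
    by blast+
  have "{U :: s7 set. U \<noteq> {}} \<noteq> {}" by blast
  then show ?thesis
    unfolding comm_ai_semiring_def power_semiring_def alg.simps
    by (intro conjI ballI)
      (assumption | rule Un_assoc Un_commute Un_absorb assoc comm dist | simp add: ne del: Collect_empty_eq)+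
qed

section \<open>Membership of 1, a and 0 in the value of a word\<close>

lemma hom_P7_word_plus:
  assumes "h \<in> alg_hom term_alg P7" "u \<noteq> {#}" "w \<noteq> {#}"
  shows "h {u + w} = {a * b | a b. a \<in> h {u} \<and> b \<in> h {w}}"
  using hom_word_plus[OF assms] by (simp add: power_semiring_def)

lemma hom_P7_nonempty:
  "h \<in> alg_hom term_alg P7 \<Longrightarrow> U \<in> carr term_alg \<Longrightarrow> h U \<noteq> {}"
  using hom_closed[of h term_alg P7 U] by (auto simp: power_semiring_def)

lemma s7_eq_times:
  "S7_one = b * c \<longleftrightarrow> b = S7_one \<and> c = S7_one"
  "S7_a = b * c \<longleftrightarrow> b = S7_a \<and> c = S7_one \<or> b = S7_one \<and> c = S7_a"
  "S7_zero = b * c \<longleftrightarrow> b = S7_zero \<or> c = S7_zero \<or> b = S7_a \<and> c = S7_a"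
  by (cases b; cases c; simp add: times_s7_def)+

text \<open>A product in \<open>s7\<close> is 1 if all factors are 1, a if one factor is a and the
  others are 1, and 0 if some factor is 0 or two factors are a. Removing \<open>{#x#}\<close> takes
  away a single occurrence, so in the last two clauses a repeated letter counts as a further factor.
  In the last clause the other factors are free because values are nonempty sets.\<close>

lemma hom_P7_word:
  assumes h: "h \<in> alg_hom term_alg P7" and w: "w \<noteq> {#}"
  shows one_in_hom_word: "S7_one \<in> h {w} \<longleftrightarrow> (\<forall>x\<in>#w. S7_one \<in> h {{#x#}})" (is ?one)
    and a_in_hom_word: "S7_a \<in> h {w} \<longleftrightarrow>
      (\<exists>x\<in>#w. S7_a \<in> h {{#x#}} \<and> (\<forall>y\<in>#w - {#x#}. S7_one \<in> h {{#y#}}))" (is ?a)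
    and zero_in_hom_word: "S7_zero \<in> h {w} \<longleftrightarrow>
      (\<exists>x\<in>#w. S7_zero \<in> h {{#x#}} \<or> S7_a \<in> h {{#x#}} \<and> (\<exists>y\<in>#w - {#x#}. S7_a \<in> h {{#y#}}))" (is ?zero)
proof -
  have some: "S7_zero \<in> h {w} \<or> S7_a \<in> h {w} \<or> S7_one \<in> h {w}" if w: "w \<noteq> {#}" for w
  proof -
    obtain e where "e \<in> h {w}" using hom_P7_nonempty[OF h, of "{w}"] w by (auto simp: carr_term_alg)
    then show ?thesis by (cases e) simp_all
  qed
  have "?one \<and> ?a \<and> ?zero"
    using w
  proof (induction w)
    case (add i w)
    show ?case
    proof (cases "w = {#}")
      case False
      note IH = add.IH[OF False]
      note IH_one = IH[THEN conjunct1] and IH_a = IH[THEN conjunct2, THEN conjunct1]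
        and IH_zero = IH[THEN conjunct2, THEN conjunct2]
      have step: "e \<in> h {add_mset i w} \<longleftrightarrow> (\<exists>a\<in>h {{#i#}}. \<exists>b\<in>h {w}. e = a * b)" for e
        using hom_P7_word_plus[OF h, of "{#i#}" w] False by auto
      have one: "S7_one \<in> h {add_mset i w} \<longleftrightarrow> S7_one \<in> h {{#i#}} \<and> S7_one \<in> h {w}"
        unfolding step s7_eq_times by blast
      have a: "S7_a \<in> h {add_mset i w} \<longleftrightarrow>
          S7_a \<in> h {{#i#}} \<and> S7_one \<in> h {w} \<or> S7_one \<in> h {{#i#}} \<and> S7_a \<in> h {w}"
        unfolding step s7_eq_times by blast
      have zero: "S7_zero \<in> h {add_mset i w} \<longleftrightarrow>
          S7_zero \<in> h {{#i#}} \<or> S7_zero \<in> h {w} \<or> S7_a \<in> h {{#i#}} \<and> S7_a \<in> h {w}"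
      \<comment> \<open>Nonemptiness of both values supplies a factor against which 0 can be
        multiplied.\<close>
      proof -
        obtain b c where "b \<in> h {{#i#}}" "c \<in> h {w}" using some[OF False] some[of "{#i#}"] by auto
        then show ?thesis unfolding step s7_eq_times by auto
      qed
      \<comment> \<open>If the new letter takes a, any letter of \<open>w\<close> that can take a
        should yield 0, whereas the recursion demands \<open>S7_a \<in> h {w}\<close>. The two
        differ only when a remaining letter cannot take 1, and then 0 is already in
        \<open>h {w}\<close>.\<close>
      have later: "S7_zero \<in> h {w} \<or> S7_a \<in> h {w}" if y: "y \<in># w" "S7_a \<in> h {{#y#}}" for y
      proof (cases "\<forall>z\<in>#w - {#y#}. S7_one \<in> h {{#z#}}")
        case True
        then have "S7_a \<in> h {w}" unfolding IH_a using y by (intro bexI[of _ y]) simp_all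
        then show ?thesis ..
      next
        case False
        then obtain z where z: "z \<in># w - {#y#}" "S7_one \<notin> h {{#z#}}" by blast
        then have "S7_zero \<in> h {{#z#}} \<or> S7_a \<in> h {{#z#}}" using some[of "{#z#}"] by auto
        moreover have "z \<in># w" using z(1) by (meson in_diffD)
        moreover have "y \<in># w - {#z#}" using y(1) z(1) by (cases "y = z") (simp_all add: in_diff_count)
        ultimately have "S7_zero \<in> h {w}" unfolding IH_zero using y(2) by (intro bexI[of _ z]) auto
        then show ?thesis ..
      qed
      \<comment> \<open>Either the distinguished occurrence is the new letter, leaving
        \<open>w\<close>, or it lies in \<open>w\<close> and the new letter is among the remaining
        ones.\<close>
      have split: "(\<exists>x\<in>#add_mset i w. Q x (add_mset i w - {#x#})) \<longleftrightarrow>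
          Q i w \<or> (\<exists>x\<in>#w. Q x (add_mset i (w - {#x#})))" for Q
      proof -
        have "(\<exists>x\<in>#w. Q x (add_mset i w - {#x#})) \<longleftrightarrow> (\<exists>x\<in>#w. Q x (add_mset i (w - {#x#})))"
          by (rule bex_cong) simp_all
        then show ?thesis by (simp only: set_mset_add_mset_insert bex_simps add_mset_remove_trivial)
      qed
      have A: "(\<exists>x\<in>#add_mset i w. S7_a \<in> h {{#x#}} \<and> (\<forall>y\<in>#add_mset i w - {#x#}. S7_one \<in> h {{#y#}}))
          \<longleftrightarrow> S7_a \<in> h {{#i#}} \<and> S7_one \<in> h {w} \<or> S7_one \<in> h {{#i#}} \<and> S7_a \<in> h {w}"
        by (rule trans[OF split[where Q = "\<lambda>x u. S7_a \<in> h {{#x#}} \<and> (\<forall>y\<in>#u. S7_one \<in> h {{#y#}})"]])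
          (unfold IH_one IH_a set_mset_add_mset_insert ball_simps(7), blast)
      have Z: "(\<exists>x\<in>#add_mset i w. S7_zero \<in> h {{#x#}} \<or>
            S7_a \<in> h {{#x#}} \<and> (\<exists>y\<in>#add_mset i w - {#x#}. S7_a \<in> h {{#y#}}))
          \<longleftrightarrow> S7_zero \<in> h {{#i#}} \<or> S7_zero \<in> h {w} \<or> S7_a \<in> h {{#i#}} \<and> S7_a \<in> h {w}"
      proof -
        have "S7_zero \<in> h {w} \<or> S7_a \<in> h {{#i#}} \<and> S7_a \<in> h {w} \<longleftrightarrow>
            S7_zero \<in> h {w} \<or> S7_a \<in> h {{#i#}} \<and> (\<exists>y\<in>#w. S7_a \<in> h {{#y#}})"
          using later IH_a[THEN iffD1] by blast
        then show ?thesis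
          by (intro trans[OF split[where Q = "\<lambda>x u. S7_zero \<in> h {{#x#}} \<or> S7_a \<in> h {{#x#}} \<and> (\<exists>y\<in>#u. S7_a \<in> h {{#y#}})"]])
            (unfold IH_zero set_mset_add_mset_insert bex_simps(5), blast)
      qed
      have "(\<forall>x\<in>#add_mset i w. S7_one \<in> h {{#x#}}) \<longleftrightarrow> S7_one \<in> h {{#i#}} \<and> S7_one \<in> h {w}"
        by (simp add: IH_one)
      then show ?thesis unfolding A Z one a zero by blast
    qed auto
  qed simp
  then show ?one ?a ?zero by blast+
qed

section \<open>Validity of an inequality in the power semiring as a covering condition\<close>

lemma hom_P7_Union:
  assumes h: "h \<in> alg_hom term_alg P7" and U: "U \<in> carr term_alg"
  shows "h U = (\<Union>w\<in>U. h {w})"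
proof -
  have "finite U" "U \<noteq> {}" "{#} \<notin> U" using U by (auto simp: carr_term_alg)
  then show ?thesis
  proof (induction rule: finite_ne_induct)
    case (insert w U)
    then have "h ({w} \<union> U) = h {w} \<union> h U"
      by (subst hom_Un[OF h]) (auto simp: carr_term_alg power_semiring_def)
    then show ?case using insert by auto
  qed simp
qed

lemma satisfies_le_P7_iff_subset:
  assumes "v \<in> carr term_alg" "w \<noteq> {#}"
  shows "satisfies_le P7 {w} v \<longleftrightarrow> (\<forall>h\<in>alg_hom term_alg P7. h {w} \<subseteq> h v)"
proof -
  have "h (v \<union> {w}) = h v \<union> h {w}" if "h \<in> alg_hom term_alg P7" for h
    using hom_Un[OF that assms(1), of "{w}"] assms(2) by (simp add: carr_term_alg power_semiring_def)
  then show ?thesis unfolding satisfies_le_def satisfies_eq_def by (metis sup.absorb_iff1)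
qed

lemma ex_hom_P7:
  assumes "\<And>i. \<psi> i \<noteq> {}"
  obtains h where "h \<in> alg_hom term_alg P7" "\<And>i. h {{#i#}} = \<psi> i"
proof -
  have "range \<psi> \<subseteq> carr P7" using assms by (auto simp: power_semiring_def)
  then show thesis using evaluation_exists[OF comm_ai_semiring_P7] that by metis
qed

text \<open>Each of the three conditions is read off from one test assignment, by tracing a value of
  \<open>w\<close> to a summand of \<open>v\<close> that attains it.\<close>

lemma satisfies_le_P7_imp_covers:
  assumes v: "v \<in> carr term_alg" and w: "w \<noteq> {#}" and le: "satisfies_le P7 {w} v"
  shows "covers v w"
proof -
  have transfer: "\<exists>u\<in>v. e \<in> h {u}" if "h \<in> alg_hom term_alg P7" "e \<in> h {w}" for h e
  proof -
    have "e \<in> h v" using le that by (auto simp: satisfies_le_P7_iff_subset[OF v w])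
    then show ?thesis unfolding hom_P7_Union[OF that(1) v] by blast
  qed
  have ne: "u \<noteq> {#}" if "u \<in> v" for u using v that by (auto simp: carr_term_alg)
  have twoI: "2 \<le> count u x" if "x \<in># u - {#x#}" for u :: word and x
  proof -
    have "0 < count (u - {#x#}) x" using that by (simp only: count_greater_zero_iff)
    then show ?thesis by simp
  qed
  have twoD: "x \<in># w - {#x#}" if "2 \<le> count w x" for x
  proof -
    have "0 < count (w - {#x#}) x" using that by simp
    then show ?thesis by (simp only: count_greater_zero_iff)
  qed
  have keep: "y \<in># u - {#x#} \<longleftrightarrow> y \<in># u" if "y \<noteq> x" for x y and u :: word
    using that by (simp add: in_diff_count)
  have a: "\<exists>u\<in>v. set_mset u \<subseteq> set_mset w \<and> x \<in># u \<and> (count w x = 1 \<longrightarrow> count u x = 1)"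
    if x: "x \<in># w" for x
  proof -
    \<comment> \<open>A summand can attain a only through one occurrence of \<open>x\<close>, all
      its other occurrences of letters taking 1. The value 0 keeps out letters not in
      \<open>w\<close>; withholding 1 from a linear \<open>x\<close> keeps out a second occurrence
      of \<open>x\<close>, while a nonlinear \<open>x\<close> needs 1 for \<open>w\<close> itself to
      attain a.\<close>
    let ?\<psi> = "\<lambda>y. if y = x then (if count w x = 1 then {S7_a} else {S7_a, S7_one})
      else if y \<in># w then {S7_one} else {S7_zero}"
    obtain h where h: "h \<in> alg_hom term_alg P7" and hv: "\<And>i. h {{#i#}} = ?\<psi> i"
      by (rule ex_hom_P7[of ?\<psi>]) auto
    have "S7_one \<in> ?\<psi> y" if "y \<in># w - {#x#}" for y
    proof (cases "y = x")
      case True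
      then show ?thesis using twoI[of x w] that by auto
    next
      case False
      then show ?thesis using in_diffD[OF that] by auto
    qed
    then have "S7_a \<in> h {w}" unfolding a_in_hom_word[OF h w] hv using x by (intro bexI[of _ x]) auto
    then obtain u where u: "u \<in> v" "S7_a \<in> h {u}" using transfer[OF h] by blast
    then obtain z where z: "z \<in># u" "S7_a \<in> ?\<psi> z" "\<And>y. y \<in># u - {#z#} \<Longrightarrow> S7_one \<in> ?\<psi> y"
      unfolding a_in_hom_word[OF h ne[OF u(1)]] hv by blast
    then have zx: "z = x" by (auto split: if_splits)
    have "y \<in># w" if "y \<in># u" for y
    proof (cases "y = x")
      case False
      then show ?thesis using z(3)[of y] that zx keep[OF False] by (auto split: if_splits)
    qed (use x in simp)
    moreover have "count u x = 1" if "count w x = 1"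
    proof (rule ccontr)
      assume "count u x \<noteq> 1"
      moreover have "0 < count u x" using z(1) zx by simp
      ultimately have "2 \<le> count u x" by linarith
      then have "0 < count (u - {#x#}) x" by simp
      then have "x \<in># u - {#x#}" by (simp only: count_greater_zero_iff)
      then show False using z(3)[of x] zx that by auto
    qed
    ultimately show ?thesis using u(1) z(1) zx by blast
  qed
  have sq: "twice_covered x v" if x: "2 \<le> count w x" for x
  proof -
    \<comment> \<open>Here 0 arises only from two occurrences of \<open>x\<close>.\<close>
    let ?\<psi> = "\<lambda>y. if y = x then {S7_a} else {S7_one}"
    obtain h where h: "h \<in> alg_hom term_alg P7" and hv: "\<And>i. h {{#i#}} = ?\<psi> i"
      by (rule ex_hom_P7[of ?\<psi>]) auto
    have "S7_zero \<in> h {w}" unfolding zero_in_hom_word[OF h w] hv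
      using twoD[OF x] in_diffD[OF twoD[OF x]] by (intro bexI[of _ x]) auto
    then obtain u where u: "u \<in> v" "S7_zero \<in> h {u}" using transfer[OF h] by blast
    then have "x \<in># u - {#x#}"
      unfolding zero_in_hom_word[OF h ne[OF u(1)]] hv by (auto split: if_splits)
    then show ?thesis using twoI u(1) by (auto simp: twice_covered_def)
  qed
  have xy: "twice_covered x v \<or> twice_covered y v \<or> (\<exists>u\<in>v. x \<in># u \<and> y \<in># u)"
    if x: "x \<in># w" and y: "y \<in># w" and "x \<noteq> y" for x y
  proof -
    \<comment> \<open>Here 0 arises only from two occurrences of letters among \<open>x\<close> and
      \<open>y\<close>, that is, from a square of one of them or from the pair.\<close>
    let ?\<psi> = "\<lambda>z. if z = x \<or> z = y then {S7_a} else {S7_one}"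
    obtain h where h: "h \<in> alg_hom term_alg P7" and hv: "\<And>i. h {{#i#}} = ?\<psi> i"
      by (rule ex_hom_P7[of ?\<psi>]) auto
    have "y \<in># w - {#x#}" using keep[of y x w] y \<open>x \<noteq> y\<close> by auto
    then have "S7_zero \<in> h {w}" unfolding zero_in_hom_word[OF h w] hv
      using x by (intro bexI[of _ x]) auto
    then obtain u where u: "u \<in> v" "S7_zero \<in> h {u}" using transfer[OF h] by blast
    then obtain s t where "s \<in># u" "t \<in># u - {#s#}" "s \<in> {x, y}" "t \<in> {x, y}"
      unfolding zero_in_hom_word[OF h ne[OF u(1)]] hv by (auto split: if_splits)
    moreover from this have "t \<in># u" by (meson in_diffD)
    ultimately show ?thesis using twoI u(1) unfolding twice_covered_def by blast
  qed
  show ?thesis unfolding covers_def using a sq xy by blast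
qed

text \<open>The values 1 and a, and a 0 due to a letter valued 0, are attained on the summand
  \<open>f x\<close> given by the first condition. A 0 due to two occurrences valued a is attained
  on a summand divisible by a square or by the pair; its other letters may take any value.\<close>

lemma covers_imp_satisfies_le_P7:
  assumes v: "v \<in> carr term_alg" and w: "w \<noteq> {#}" and cov: "covers v w"
  shows "satisfies_le P7 {w} v"
  unfolding satisfies_le_P7_iff_subset[OF v w]
proof (intro ballI subsetI)
  fix h e assume h: "h \<in> alg_hom term_alg P7" and e: "e \<in> h {w}"
  note Union = hom_P7_Union[OF h v]
  have ne: "u \<noteq> {#}" if "u \<in> v" for u using v that by (auto simp: carr_term_alg)
  have twice: "S7_zero \<in> h v" if a: "S7_a \<in> h {{#x#}}" and tw: "twice_covered x v" for x
  proof -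
    obtain u where u: "u \<in> v" "2 \<le> count u x" using tw by (auto simp: twice_covered_def)
    have "0 < count (u - {#x#}) x" using u(2) by simp
    then have "x \<in># u - {#x#}" by (simp only: count_greater_zero_iff)
    then have "S7_zero \<in> h {u}"
      unfolding zero_in_hom_word[OF h ne[OF u(1)]] using a by (meson in_diffD)
    then show ?thesis using u(1) Union by blast
  qed
  obtain f where f: "\<And>x. x \<in># w \<Longrightarrow> f x \<in> v \<and> set_mset (f x) \<subseteq> set_mset w \<and> x \<in># f x \<and>
      (count w x = 1 \<longrightarrow> count (f x) x = 1)"
    using cov unfolding covers_def by metis
  show "e \<in> h v"
  proof (cases e)
    case S7_one
    obtain x where x: "x \<in># w" using w by auto
    have "S7_one \<in> h {f x}"
      using e f[OF x] unfolding S7_one one_in_hom_word[OF h w] one_in_hom_word[OF h ne[OF conjunct1[OF f[OF x]]]]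
      by blast
    then show ?thesis using f[OF x] Union S7_one by blast
  next
    case S7_a
    then obtain x where x: "x \<in># w" "S7_a \<in> h {{#x#}}" "\<And>y. y \<in># w - {#x#} \<Longrightarrow> S7_one \<in> h {{#y#}}"
      using e unfolding S7_a a_in_hom_word[OF h w] by blast
    \<comment> \<open>The remaining letters of \<open>f x\<close> must all be able to take 1. This
      is known for those of \<open>w - {#x#}\<close>; a further \<open>x\<close> in
      \<open>f x\<close> is possible only if \<open>x\<close> is repeated in \<open>w\<close> as
      well.\<close>
    have "y \<in># w - {#x#}" if y: "y \<in># f x - {#x#}" for y
    proof -
      have "y \<in># w" using in_diffD[OF y] f[OF x(1)] by blast
      moreover have "1 < count w x" if "y = x"
      proof -
        have "0 < count (f x - {#x#}) x" using y that by (simp only: count_greater_zero_iff)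
        then have "count (f x) x \<noteq> 1" by simp
        then have "count w x \<noteq> 1" using f[OF x(1)] by blast
        moreover have "0 < count w x" using x(1) by simp
        ultimately show ?thesis by linarith
      qed
      ultimately have "0 < count (w - {#x#}) y" by auto
      then show ?thesis by (simp only: count_greater_zero_iff)
    qed
    then have "S7_a \<in> h {f x}"
      using x f[OF x(1)] unfolding a_in_hom_word[OF h ne[OF conjunct1[OF f[OF x(1)]]]] by blast
    then show ?thesis using f[OF x(1)] Union S7_a by blast
  next
    case S7_zero
    then obtain x where x: "x \<in># w" "S7_zero \<in> h {{#x#}} \<or>
        S7_a \<in> h {{#x#}} \<and> (\<exists>y\<in>#w - {#x#}. S7_a \<in> h {{#y#}})"
      using e unfolding S7_zero zero_in_hom_word[OF h w] by blast
    show ?thesis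
    proof (cases "S7_zero \<in> h {{#x#}}")
      case True
      then have "S7_zero \<in> h {f x}"
        using f[OF x(1)] unfolding zero_in_hom_word[OF h ne[OF conjunct1[OF f[OF x(1)]]]] by blast
      then show ?thesis using f[OF x(1)] Union S7_zero by blast
    next
      case False
      then obtain y where a: "S7_a \<in> h {{#x#}}" and y: "y \<in># w - {#x#}" "S7_a \<in> h {{#y#}}"
        using x(2) by blast
      have yw: "y \<in># w" using in_diffD[OF y(1)] .
      show ?thesis
      proof (cases "y = x")
        case True
        then have "0 < count (w - {#x#}) x" using y(1) by (simp only: count_greater_zero_iff)
        then have "twice_covered x v" using cov by (auto simp: covers_def)
        then show ?thesis using twice[OF a] S7_zero by simp
      next
        case False
        then consider "twice_covered x v" | "twice_covered y v" | u where "u \<in> v" "x \<in># u" "y \<in># u"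
          using cov x(1) yw unfolding covers_def by metis
        then show ?thesis
        proof cases
          case (3 u)
          have "y \<in># u - {#x#}" using 3 False by (simp add: in_diff_count)
          then have "S7_zero \<in> h {u}"
            unfolding zero_in_hom_word[OF h ne[OF 3(1)]] using 3 a y(2) by blast
          then show ?thesis using 3(1) Union S7_zero by blast
        qed (use twice a y(2) S7_zero in auto)
      qed
    qed
  qed
qed

section \<open>Soundness\<close>

lemma count_mset_upt: "count (mset [a..<b]) x = (if x \<in> {a..<b} then 1 else 0)"
  by (metis distinct_count_atmost_1 distinct_upt set_upt)

text \<open>This writes the word as the product of all its variables times that of the nonlinear
  ones, the form in which counts and substitutions are easy to compute.\<close>

lemma q_eq_mset: "k \<le> n + 1 \<Longrightarrow> q n k = mset [1..<n + 2] + mset [k + 1..<n + 2]"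
proof (rule multiset_eqI)
  fix x assume k: "k \<le> n + 1"
  have "count (\<Sum>i=1..k. {#i#}) x = (if 1 \<le> x \<and> x \<le> k then 1 else 0)"
    by (simp add: count_sum count_single)
  moreover have "count (\<Sum>i=k+1..n+1. sq i) x = (if k + 1 \<le> x \<and> x \<le> n + 1 then 2 else 0)"
    by (simp add: count_sum sq_def if_distrib[of "\<lambda>t. Suc t"] cong: if_cong)
  ultimately show "count (q n k) x = count (mset [1..<n + 2] + mset [k + 1..<n + 2]) x"
    using k unfolding q_def count_union count_mset_upt by auto
qed

lemma set_mset_q: "k \<le> n + 1 \<Longrightarrow> set_mset (q n k) = {1..n + 1}"
  by (auto simp: q_eq_mset)

lemma q_nonempty: "k \<le> n + 1 \<Longrightarrow> q n k \<noteq> {#}"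
  using set_mset_q[of k n] by auto

lemma count_q:
  "k \<le> n + 1 \<Longrightarrow> x \<in> {1..n + 1} \<Longrightarrow> count (q n k) x = (if x \<le> k then 1 else 2)"
  unfolding q_eq_mset count_union count_mset_upt by auto

text \<open>Pairs need checking only among the linear variables: an index above \<open>k\<close>
  brings its square along by \<open>sqs\<close>.\<close>

lemma covers_q:
  assumes k: "k \<le> n + 1"
    and occ: "\<And>i. i \<in> {1..n + 1} \<Longrightarrow>
      \<exists>u\<in>v. set_mset u \<subseteq> {1..n + 1} \<and> i \<in># u \<and> (i \<le> k \<longrightarrow> count u i = 1)"
    and sqs: "\<And>i. i \<in> {k + 1..n + 1} \<Longrightarrow> twice_covered i v"
    and pairs: "\<And>i j. 1 \<le> i \<Longrightarrow> i < j \<Longrightarrow> j \<le> k \<Longrightarrow>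
      twice_covered i v \<or> twice_covered j v \<or> (\<exists>u\<in>v. i \<in># u \<and> j \<in># u)"
  shows "covers v (q n k)"
proof -
  have two: "i \<in> {k + 1..n + 1}" if "2 \<le> count (q n k) i" for i
  proof -
    have "i \<in># q n k" using that by (intro count_inI) simp
    then have "i \<in> {1..n + 1}" using set_mset_q[OF k] by simp
    then show ?thesis using that count_q[OF k] by (cases "i \<le> k") auto
  qed
  have all: "twice_covered i v \<or> twice_covered j v \<or> (\<exists>u\<in>v. i \<in># u \<and> j \<in># u)"
    if "i \<in> {1..n + 1}" "j \<in> {1..n + 1}" "i \<noteq> j" for i j
  proof (cases "i \<le> k \<and> j \<le> k")
    case True
    then show ?thesis using pairs[of i j] pairs[of j i] that by (cases "i < j") auto
  next
    case False
    then show ?thesis using sqs[of i] sqs[of j] that by auto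
  qed
  show ?thesis
    unfolding covers_def set_mset_q[OF k]
  proof (intro conjI ballI allI impI)
    fix i assume i: "i \<in> {1..n + 1}"
    have "count (q n k) i = 1 \<longleftrightarrow> i \<le> k" using count_q[OF k i] by simp
    then show "\<exists>u\<in>v. set_mset u \<subseteq> {1..n + 1} \<and> i \<in># u \<and> (count (q n k) i = 1 \<longrightarrow> count u i = 1)"
      using occ[OF i] by simp
  next
    fix i assume "2 \<le> count (q n k) i"
    then show "twice_covered i v" by (rule sqs[OF two])
  qed (rule all)
qed

lemma satisfies_le_P7_q:
  assumes "k \<le> n + 1" "v \<in> carr term_alg" "covers v (q n k)"
  shows "satisfies_le P7 {q n k} v"
  using covers_imp_satisfies_le_P7[OF assms(2) q_nonempty[OF assms(1)] assms(3)] .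

lemma twice_covered_sq: "sq i + u \<in> v \<Longrightarrow> twice_covered i v"
  unfolding twice_covered_def by (rule bexI[of _ "sq i + u"]) (simp_all add: sq_def)

section \<open>Validity of the five identities in the power semiring\<close>

lemma identity1_P7: "identity1 P7"
proof -
  \<comment> \<open>The condition \<open>covers\<close> only distinguishes multiplicities 0, 1 and
    at least 2, so it holds in both directions.\<close>
  have le: "satisfies_le P7 {{#0, 0, 0#}} {{#0, 0#}}" "satisfies_le P7 {{#0, 0#}} {{#0, 0, 0#}}"
    by (rule covers_imp_satisfies_le_P7;
        simp add: carr_term_alg covers_def twice_covered_def)+
  show ?thesis
    using le unfolding identity1_def satisfies_le_def satisfies_eq_def by (metis Un_commute)
qed

lemma identity2_if_identity3:
  assumes "identity3 S"
  shows "identity2 S"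
  unfolding identity2_def
proof (intro allI impI)
  fix n :: nat and w :: "nat \<Rightarrow> word"
  assume n: "1 \<le> n" and w: "\<forall>i\<in>{1..n+1}. set_mset (w i) \<subseteq> {1..n+1}"
  have "satisfies_le S {\<Sum>i=1..n+1. sq i}
    ((\<lambda>i. {#i#} + ({#i#} + w i)) ` {1..n+1} \<union> (\<lambda>i. sq i + w i) ` {1..n+1})"
    using assms[unfolded identity3_def, rule_format, OF n, of "\<lambda>i. {#i#} + w i" w] w by auto
  then show "satisfies_le S {\<Sum>i=1..n+1. sq i} ((\<lambda>i. sq i + w i) ` {1..n+1})"
    by (simp add: sq_def)
qed

lemma identity3_P7: "identity3 P7"
  unfolding identity3_def
proof (intro allI impI)
  fix n :: nat and w p :: "nat \<Rightarrow> word"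
  assume w: "\<forall>i\<in>{1..n+1}. set_mset (w i) \<subseteq> {1..n+1}"
  let ?v = "(\<lambda>i. {#i#} + w i) ` {1..n+1} \<union> (\<lambda>i. sq i + p i) ` {1..n+1}"
  have "?v \<in> carr term_alg" by (auto simp: carr_term_alg sq_def)
  \<comment> \<open>The left-hand side of (3) is \<open>q n 0\<close>: it has no linear variable, so
    there are no pairs to check.\<close>
  moreover have "covers ?v (q n 0)"
  proof (rule covers_q)
    fix i assume i: "i \<in> {1..n+1}"
    show "\<exists>u\<in>?v. set_mset u \<subseteq> {1..n + 1} \<and> i \<in># u \<and> (i \<le> 0 \<longrightarrow> count u i = 1)"
      using i w by (intro bexI[of _ "{#i#} + w i"]) auto
  next
    fix i assume "i \<in> {0+1..n+1}"
    then show "twice_covered i ?v" by (intro twice_covered_sq[of i "p i"]) auto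
  qed auto
  ultimately show "satisfies_le P7 {\<Sum>i=1..n+1. sq i} ?v"
    using satisfies_le_P7_q[of 0 n ?v] by (simp add: q_def)
qed

text \<open>The summand for \<open>i\<close> consists of \<open>i\<close> and a cofactor that avoids
  \<open>i\<close> when \<open>i\<close> is linear. This settles the occurrence condition for both
  (4) and (5).\<close>

lemma admissible_occurrence:
  assumes adm: "admissible n k w" and i: "i \<in> {1..n + 1}"
    and sub: "(\<lambda>i. {#i#} + w i) ` {1..n+1} \<subseteq> v"
  shows "\<exists>u\<in>v. set_mset u \<subseteq> {1..n + 1} \<and> i \<in># u \<and> (i \<le> k \<longrightarrow> count u i = 1)"
proof (rule bexI[of _ "{#i#} + w i"])
  show "{#i#} + w i \<in> v" using i sub by blast
  have le: "i \<le> k \<Longrightarrow> set_mset (w i) \<subseteq> {1..n + 1} - {i}"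
    and gt: "\<not> i \<le> k \<Longrightarrow> set_mset (w i) \<subseteq> {1..n + 1}"
    using adm i by (auto simp: admissible_def)
  have "i \<notin># w i" if "i \<le> k" using le[OF that] by blast
  then have "count ({#i#} + w i) i = 1" if "i \<le> k" using that by (simp add: not_in_iff)
  moreover have "set_mset (w i) \<subseteq> {1..n + 1}" using le gt by blast
  ultimately show "set_mset ({#i#} + w i) \<subseteq> {1..n + 1} \<and> i \<in># {#i#} + w i \<and>
      (i \<le> k \<longrightarrow> count ({#i#} + w i) i = 1)" using i by auto
qed

lemma identity4_P7: "identity4 P7"
  unfolding identity4_def
proof (intro allI ballI impI)
  fix n k :: nat and w p :: "nat \<Rightarrow> word"
  assume k: "k \<in> {1..n+1}" and adm: "admissible n k w"
  let ?v = "(\<lambda>i. {#i#} + w i) ` {1..n+1} \<union> (\<lambda>i. sq i + p i) ` {1..k-1} \<union>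
    (\<lambda>i. sq i + p i) ` {k+1..n+1}"
  have "?v \<in> carr term_alg" by (auto simp: carr_term_alg sq_def)
  moreover have "covers ?v (q n k)"
  proof (rule covers_q)
    fix i assume i: "i \<in> {1..n+1}"
    show "\<exists>u\<in>?v. set_mset u \<subseteq> {1..n + 1} \<and> i \<in># u \<and> (i \<le> k \<longrightarrow> count u i = 1)"
      by (rule admissible_occurrence[OF adm i]) blast
  next
    fix i assume "i \<in> {k+1..n+1}"
    then show "twice_covered i ?v" by (intro twice_covered_sq[of i "p i"]) auto
  next
    fix i j assume "1 \<le> i" "i < j" "j \<le> k"
    \<comment> \<open>The smaller index of a linear pair is at most \<open>k-1\<close>, so only the
      square of the variable \<open>k\<close> may be missing.\<close>
    then have "twice_covered i ?v" by (intro twice_covered_sq[of i "p i"]) auto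
    then show "twice_covered i ?v \<or> twice_covered j ?v \<or> (\<exists>u\<in>?v. i \<in># u \<and> j \<in># u)" ..
  qed (use k in auto)
  ultimately show "satisfies_le P7 {q n k} ?v" using satisfies_le_P7_q[of k n ?v] k by simp
qed

lemma identity5_P7: "identity5 P7"
  unfolding identity5_def
proof (intro allI ballI impI)
  fix n k l :: nat and w p :: "nat \<Rightarrow> word" and p' :: "nat \<Rightarrow> nat \<Rightarrow> word"
  assume k: "k \<in> {1..n+1}" and l: "l < k - 1" and adm: "admissible n k w"
  let ?r = "{{#i, j#} + p' i j | i j. l + 1 \<le> i \<and> i < j \<and> j \<le> k}"
  let ?v = "(\<lambda>i. {#i#} + w i) ` {1..n+1} \<union> (\<lambda>i. sq i + p i) ` {1..l} \<union> ?r \<union>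
    (\<lambda>i. sq i + p i) ` {k+1..n+1}"
  have "?r \<subseteq> (\<lambda>(i, j). {#i, j#} + p' i j) ` ({..k} \<times> {..k})" by force
  then have "finite ?r" by (rule finite_subset) simp
  then have "?v \<in> carr term_alg" by (auto simp: carr_term_alg sq_def)
  moreover have "covers ?v (q n k)"
  proof (rule covers_q)
    fix i assume i: "i \<in> {1..n+1}"
    show "\<exists>u\<in>?v. set_mset u \<subseteq> {1..n + 1} \<and> i \<in># u \<and> (i \<le> k \<longrightarrow> count u i = 1)"
      by (rule admissible_occurrence[OF adm i]) blast
  next
    fix i assume "i \<in> {k+1..n+1}"
    then show "twice_covered i ?v" by (intro twice_covered_sq[of i "p i"]) auto
  next
    fix i j assume ij: "1 \<le> i" "i < j" "j \<le> k"
    show "twice_covered i ?v \<or> twice_covered j ?v \<or> (\<exists>u\<in>?v. i \<in># u \<and> j \<in># u)"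
    \<comment> \<open>Up to \<open>l\<close> the square of the smaller index is present; beyond
      \<open>l\<close> both indices belong to the range of the pair summands.\<close>
    proof (cases "i \<le> l")
      case True
      then have "twice_covered i ?v" using ij by (intro twice_covered_sq[of i "p i"]) auto
      then show ?thesis ..
    next
      case False
      then have "{#i, j#} + p' i j \<in> ?r" using ij by force
      then have "{#i, j#} + p' i j \<in> ?v" by blast
      moreover have "i \<in># {#i, j#} + p' i j" "j \<in># {#i, j#} + p' i j" by simp_all
      ultimately show ?thesis by blast
    qed
  qed (use k in auto)
  ultimately show "satisfies_le P7 {q n k} ?v" using satisfies_le_P7_q[of k n ?v] k by simp
qed

section \<open>Completeness\<close>

lemma hom_absorb_cube:
  assumes id1: "identity1 S" and h: "h \<in> alg_hom term_alg S" and x: "2 \<le> count w x"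
  shows "h {add_mset x w} = h {w}"
proof -
  obtain w' where w: "w = {#x, x#} + w'"
  proof
    have "{#x, x#} \<subseteq># w" using x by (auto simp: subseteq_mset_def)
    then show "w = {#x, x#} + (w - {#x, x#})" by (rule subset_mset.add_diff_inverse[symmetric])
  qed
  \<comment> \<open>Identity (1) is instantiated by sending every variable to
    \<open>x\<close>.\<close>
  have cube: "h {{#x, x, x#}} = h {{#x, x#}}"
    using id1[unfolded identity1_def satisfies_eq_def, rule_format, OF hom_rename[OF h, of "\<lambda>_. x"]]
    by (simp add: rename_def)
  show ?thesis
  \<comment> \<open>The empty word is no term, so an empty cofactor cannot be multiplied on and is
    treated separately.\<close>
  proof (cases "w' = {#}")
    case False
    then have "h {{#x, x, x#} + w'} = h {{#x, x#} + w'}"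
      using hom_word_plus[OF h, of "{#x, x, x#}" w'] hom_word_plus[OF h, of "{#x, x#}" w'] cube by simp
    then show ?thesis by (simp add: w)
  qed (use cube w in simp)
qed

text \<open>Both words reduce to their multiset intersection: a letter with a surplus occurs at
  least twice in both words, so the surplus is absorbed by (1).\<close>

lemma hom_eq_of_truncated_counts:
  assumes id1: "identity1 S" and h: "h \<in> alg_hom term_alg S"
    and eq: "\<And>x. min 2 (count w x) = min 2 (count w' x)"
  shows "h {w} = h {w'}"
proof -
  have absorb: "h {r + d} = h {r}" if "\<And>x. x \<in># d \<Longrightarrow> 2 \<le> count r x" for r d
    using that
  proof (induction d)
    case (add x d)
    have "2 \<le> count (r + d) x" using add.prems[of x] by simp
    then show ?case using hom_absorb_cube[OF id1 h] add by simp
  qed simp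
  have "h {u} = h {u \<inter># u'}" if eq: "\<And>x. min 2 (count u x) = min 2 (count u' x)" for u u'
  proof -
    have "2 \<le> count (u \<inter># u') x" if "x \<in># u - u \<inter># u'" for x
    proof -
      have "0 < count (u - u \<inter># u') x" using that by (simp only: count_greater_zero_iff)
      then have "count u' x < count u x" by simp
      then have "2 \<le> count u' x" using eq[of x] by (simp add: min_def split: if_splits)
      then show ?thesis using \<open>count u' x < count u x\<close> by simp
    qed
    then have "h {u \<inter># u' + (u - u \<inter># u')} = h {u \<inter># u'}" by (rule absorb)
    then show ?thesis by (simp only: subset_mset.add_diff_inverse[OF subset_mset.inf_le1])
  qed
  from this[OF eq] this[OF eq[symmetric]] show ?thesis by (simp only: subset_mset.inf_commute)
qed

text \<open>The renamed right-hand side \<open>t\<close> is part of \<open>v\<close>, so the word it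
  absorbs is absorbed by \<open>v\<close>. By (1) the renamed \<open>s\<close> has to match
  \<open>w\<close> only in multiplicities truncated at 2.\<close>

lemma satisfies_le_substitution:
  assumes id1: "identity1 S" and h: "h \<in> alg_hom term_alg S"
    and le: "satisfies_le S {s} t" and s: "s \<noteq> {#}" and t: "t \<in> carr term_alg"
    and v: "v \<in> carr term_alg" and sub: "rename f t \<subseteq> v"
    and eq: "\<And>x. min 2 (count (image_mset f s) x) = min 2 (count w x)" and w: "w \<noteq> {#}"
  shows "h v = h (v \<union> {w})"
proof -
  let ?t = "rename f t"
  have t': "?t \<in> carr term_alg" and s': "{image_mset f s} \<in> carr term_alg" and w': "{w} \<in> carr term_alg"
    using rename_carrI[OF t] s w by (auto simp: carr_term_alg)
  have "h ?t = h (?t \<union> {image_mset f s})"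
    using le[unfolded satisfies_le_def satisfies_eq_def, rule_format, OF hom_rename[OF h, of f]]
    by (simp add: rename_def)
  also have "\<dots> = h ?t \<oplus>\<^bsub>S\<^esub> h {image_mset f s}" by (rule hom_Un[OF h t' s'])
  also have "\<dots> = h ?t \<oplus>\<^bsub>S\<^esub> h {w}" by (simp only: hom_eq_of_truncated_counts[OF id1 h eq])
  also have "\<dots> = h (?t \<union> {w})" by (rule hom_Un[OF h t' w', symmetric])
  finally have ht: "h ?t = h (?t \<union> {w})" .
  have "h v = h (v \<union> ?t)" using sub by (simp add: Un_absorb2)
  also have "\<dots> = h v \<oplus>\<^bsub>S\<^esub> h (?t \<union> {w})" unfolding hom_Un[OF h v t'] by (rule arg_cong[OF ht])
  also have "\<dots> = h (v \<union> (?t \<union> {w}))"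
    by (rule hom_Un[OF h v Un_in_carr_term_alg[OF t' w'], symmetric])
  also have "v \<union> (?t \<union> {w}) = v \<union> {w}" using sub by blast
  finally show ?thesis .
qed

text \<open>The variables outside \<open>1..length ys\<close> are shifted so that the substitution is onto and
  arbitrary cofactors have preimages.\<close>

definition subst_list :: "nat list \<Rightarrow> nat \<Rightarrow> nat" where
  "subst_list ys i = (if i \<in> {1..length ys} then ys ! (i - 1) else i - (length ys + 1))"

lemma image_subst_list_q:
  assumes len: "length ys = n + 1" and k: "k \<le> n + 1"
  shows "image_mset (subst_list ys) (q n k) = mset ys + mset (drop k ys)"
proof -
  have "map (subst_list ys) [1..<n + 2] = ys" "map (subst_list ys) [k + 1..<n + 2] = drop k ys"
    by (rule nth_equalityI; use len k in \<open>auto simp: subst_list_def simp del: upt_Suc\<close>)+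
  then have "mset (map (subst_list ys) [1..<n + 2]) = mset ys"
    "mset (map (subst_list ys) [k + 1..<n + 2]) = mset (drop k ys)" by simp_all
  then show ?thesis unfolding q_eq_mset[OF k] image_mset_union mset_map by simp
qed

text \<open>A right inverse pulls the cofactors of actual summands back to cofactors of the
  identities. Landing in \<open>1..length ys\<close> on the listed variables gives the restriction
  on the variables of the \<open>w i\<close>.\<close>

lemma ex_section_subst_list:
  obtains \<tau> where "\<And>x. subst_list ys (\<tau> x) = x" "\<And>x. x \<in> set ys \<Longrightarrow> \<tau> x \<in> {1..length ys}"
proof -
  have "\<exists>j. subst_list ys j = x \<and> (x \<in> set ys \<longrightarrow> j \<in> {1..length ys})" for x
  proof (cases "x \<in> set ys")
    case True
    then obtain i where "i < length ys" "ys ! i = x" by (auto simp: in_set_conv_nth)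
    then show ?thesis by (intro exI[of _ "i + 1"]) (auto simp: subst_list_def)
  next
    case False
    then show ?thesis by (intro exI[of _ "x + (length ys + 1)"]) (auto simp: subst_list_def)
  qed
  then show thesis using that by metis
qed

lemma two_le_count_iff: "{#x, x#} \<subseteq># u \<longleftrightarrow> 2 \<le> count u x"
  by (auto simp: subseteq_mset_def)

lemma pair_subseteq_iff: "x \<noteq> y \<Longrightarrow> {#x, y#} \<subseteq># u \<longleftrightarrow> x \<in># u \<and> y \<in># u"
  by (auto simp: subseteq_mset_def Suc_le_eq)

text \<open>Dividing the summands provided by \<open>covers\<close> by a variable, a square or a
  pair leaves cofactors; pulled back along a section of the substitution, they specify the instance
  of (3), (4) or (5) whose image lies in \<open>v\<close>.\<close>

lemma covers_imp_hom_le: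
  assumes id1: "identity1 S" and id3: "identity3 S" and id4: "identity4 S" and id5: "identity5 S"
    and h: "h \<in> alg_hom term_alg S" and v: "v \<in> carr term_alg" and w: "w \<noteq> {#}"
    and cov: "covers v w"
  shows "h v = h (v \<union> {w})"
proof -
  obtain f where f: "\<And>x. x \<in># w \<Longrightarrow> f x \<in> v" "\<And>x. x \<in># w \<Longrightarrow> set_mset (f x) \<subseteq> set_mset w"
    "\<And>x. x \<in># w \<Longrightarrow> x \<in># f x" "\<And>x. x \<in># w \<Longrightarrow> count w x = 1 \<Longrightarrow> count (f x) x = 1"
    using cov unfolding covers_def by metis
  have "\<exists>u. twice_covered x v \<longrightarrow> u \<in> v \<and> {#x, x#} \<subseteq># u" for x
    unfolding twice_covered_def two_le_count_iff by blast
  then obtain g where g: "\<And>x. twice_covered x v \<Longrightarrow> g x \<in> v \<and> {#x, x#} \<subseteq># g x" by metis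
  have pair: "\<exists>u\<in>v. {#x, y#} \<subseteq># u"
    if "x \<in># w" "y \<in># w" "x \<noteq> y" "\<not> twice_covered x v" "\<not> twice_covered y v" for x y
    using cov that unfolding covers_def pair_subseteq_iff[OF that(3)] by blast
  \<comment> \<open>Only evaluated at pairs of variables of \<open>w\<close> neither of whose
    squares divides a summand.\<close>
  define c where "c x y = (SOME u. u \<in> v \<and> {#x, y#} \<subseteq># u)" for x y
  have c: "c x y \<in> v \<and> {#x, y#} \<subseteq># c x y"
    if "x \<in># w" "y \<in># w" "x \<noteq> y" "\<not> twice_covered x v" "\<not> twice_covered y v" for x y
  proof -
    have "\<exists>u. u \<in> v \<and> {#x, y#} \<subseteq># u" using pair[OF that] by blast
    then show ?thesis unfolding c_def by (rule someI_ex)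
  qed
  have sq_cov: "twice_covered x v" if "2 \<le> count w x" for x
    using cov that by (simp add: covers_def)
  show ?thesis
  proof (cases "\<forall>x\<in>#w. 2 \<le> count w x")
    case True
    obtain xs where xs: "set xs = set_mset w" using finite_list[OF finite_set_mset[of w]] ..
    then have xs_ne: "xs \<noteq> []" using w by auto
    define n where "n = length xs"
    \<comment> \<open>Identity (3) needs at least two variables; the repeated entry also covers the case that
      \<open>w\<close> is a power of a single variable.\<close>
    define ys where "ys = xs @ [hd xs]"
    have n: "1 \<le> n" using xs_ne by (cases xs) (auto simp: n_def)
    have len: "length ys = n + 1" by (simp add: ys_def n_def)
    have "set ys = insert (hd xs) (set xs)" by (simp add: ys_def)
    also have "\<dots> = set xs" by (rule insert_absorb[OF hd_in_set[OF xs_ne]])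
    finally have set_ys: "set ys = set_mset w" unfolding xs .
    let ?\<sigma> = "subst_list ys"
    have \<sigma>: "?\<sigma> i \<in># w" if "i \<in> {1..n+1}" for i
    proof -
      have "ys ! (i - 1) \<in> set ys" using that len by (intro nth_mem) auto
      then show ?thesis using that len set_ys by (simp add: subst_list_def)
    qed
    obtain \<tau> where \<tau>: "\<And>x. ?\<sigma> (\<tau> x) = x" "\<And>x. x \<in> set ys \<Longrightarrow> \<tau> x \<in> {1..length ys}"
      by (rule ex_section_subst_list[of ys]) (rule that; assumption)
    have inv: "image_mset ?\<sigma> (image_mset \<tau> u) = u" for u
      by (simp add: image_mset.compositionality comp_def \<tau>(1))
    define w' where "w' i = image_mset \<tau> (f (?\<sigma> i) - {#?\<sigma> i#})" for i
    define p where "p i = image_mset \<tau> (g (?\<sigma> i) - {#?\<sigma> i, ?\<sigma> i#})" for i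
    have w'_sub: "set_mset (w' i) \<subseteq> {1..n+1}" if "i \<in> {1..n+1}" for i
    proof -
      have "set_mset (f (?\<sigma> i) - {#?\<sigma> i#}) \<subseteq> set ys"
        using f(2)[OF \<sigma>[OF that]] set_ys by (auto dest: in_diffD)
      then show ?thesis using \<tau>(2) len unfolding w'_def set_image_mset by fastforce
    qed
    let ?t = "(\<lambda>i. {#i#} + w' i) ` {1..n+1} \<union> (\<lambda>i. sq i + p i) ` {1..n+1}"
    have le: "satisfies_le S {q n 0} ?t"
      using id3[unfolded identity3_def, rule_format, OF n, of w' p] w'_sub by (simp add: q_def)
    have "image_mset ?\<sigma> ({#i#} + w' i) = f (?\<sigma> i)" if "i \<in> {1..n+1}" for i
      using f(3)[OF \<sigma>[OF that]] by (simp add: w'_def inv)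
    then have "image_mset ?\<sigma> ({#i#} + w' i) \<in> v" if "i \<in> {1..n+1}" for i
      using f(1)[OF \<sigma>[OF that]] that by simp
    moreover have "image_mset ?\<sigma> (sq i + p i) \<in> v" if "i \<in> {1..n+1}" for i
    proof -
      have "twice_covered (?\<sigma> i) v" using sq_cov True \<sigma>[OF that] by blast
      note gi = g[OF this]
      have "image_mset ?\<sigma> (sq i + p i) = {#?\<sigma> i, ?\<sigma> i#} + (g (?\<sigma> i) - {#?\<sigma> i, ?\<sigma> i#})"
        by (simp add: sq_def p_def inv)
      also have "\<dots> = g (?\<sigma> i)" using gi by (intro subset_mset.add_diff_inverse) simp
      finally show ?thesis using gi by simp
    qed
    ultimately have sub: "rename ?\<sigma> ?t \<subseteq> v" unfolding rename_def by blast
    \<comment> \<open>With \<open>k = 0\<close> the image is the product of \<open>ys\<close> with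
      itself, so every letter of \<open>w\<close> has truncated multiplicity 2, the repeated entry
      included.\<close>
    have "min 2 (count (image_mset ?\<sigma> (q n 0)) x) = min 2 (count w x)" for x
    proof (cases "x \<in># w")
      case x: True
      then have "count (mset ys) x \<noteq> 0" using set_ys by (simp add: count_mset_0_iff)
      then have "2 \<le> count (mset ys) x + count (mset ys) x" by linarith
      then have "2 \<le> count (image_mset ?\<sigma> (q n 0)) x" by (simp only: image_subst_list_q[OF len] le0 drop_0 count_union)
      then show ?thesis using True x by auto
    next
      case False
      then have "count (mset ys) x = 0" using set_ys by (simp add: count_mset_0_iff)
      moreover have "count w x = 0" using False by (simp add: not_in_iff)
      ultimately show ?thesis by (simp only: image_subst_list_q[OF len] le0 drop_0 count_union)
    qed
    then show ?thesis
      using satisfies_le_substitution[OF id1 h le q_nonempty _ v sub _ w]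
      by (simp add: carr_term_alg sq_def image_iff)
  next
    case False
    \<comment> \<open>The variables of \<open>w\<close> are listed in the order required by (5):
      linear ones whose squares divide summands (indices up to \<open>l\<close>), the other linear
      ones (up to \<open>k\<close>), then the nonlinear ones.\<close>
    define L where "L = {x \<in> set_mset w. count w x = 1 \<and> twice_covered x v}"
    define R where "R = {x \<in> set_mset w. count w x = 1 \<and> \<not> twice_covered x v}"
    define Q where "Q = {x \<in> set_mset w. 2 \<le> count w x}"
    have fin: "finite L" "finite R" "finite Q" by (auto simp: L_def R_def Q_def)
    obtain ls rs ss where lists: "set ls = L" "distinct ls" "set rs = R" "distinct rs"
      "set ss = Q" "distinct ss" using finite_distinct_list fin by metis
    define ys where "ys = ls @ rs @ ss"
    define n where "n = length ys - 1"
    define k where "k = length (ls @ rs)"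
    define l where "l = length ls"
    have LRQ: "L \<union> R \<union> Q = set_mset w" "L \<inter> R = {}" "(L \<union> R) \<inter> Q = {}" "L \<union> R \<noteq> {}"
    proof -
      have "count w x = 1 \<or> 2 \<le> count w x" if "x \<in># w" for x
      proof -
        have "0 < count w x" using that by simp
        then show ?thesis by linarith
      qed
      then show "L \<union> R \<union> Q = set_mset w" "L \<union> R \<noteq> {}"
        using False unfolding L_def R_def Q_def by blast+
    qed (auto simp: L_def R_def Q_def)
    have set_ys: "set ys = set_mset w" and dist: "distinct ys"
      using lists LRQ by (auto simp: ys_def)
    \<comment> \<open>A linear variable exists in this case, as (4) and (5) require.\<close>
    have k1: "1 \<le> k" using lists LRQ(4) by (cases "ls @ rs") (auto simp: k_def)
    then have len: "length ys = n + 1" and kn: "k \<le> n + 1"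
      by (auto simp: n_def ys_def k_def)
    have k: "k \<in> {1..n+1}" using k1 kn by simp
    let ?\<sigma> = "subst_list ys"
    have \<sigma>_nth: "?\<sigma> i = ys ! (i - 1)" if "i \<in> {1..n+1}" for i using that len by (simp add: subst_list_def)
    have \<sigma>: "?\<sigma> i \<in># w" if "i \<in> {1..n+1}" for i
    proof -
      have "ys ! (i - 1) \<in> set ys" using that len by (intro nth_mem) auto
      then show ?thesis using \<sigma>_nth[OF that] set_ys by simp
    qed
    have \<sigma>_inj: "?\<sigma> i \<noteq> ?\<sigma> j" if "i \<in> {1..n+1}" "j \<in> {1..n+1}" "i \<noteq> j" for i j
    proof -
      have "i - 1 < length ys" "j - 1 < length ys" "i - 1 \<noteq> j - 1" using that len by auto
      then show ?thesis
        using \<sigma>_nth[OF that(1)] \<sigma>_nth[OF that(2)] nth_eq_iff_index_eq[OF dist] by simp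
    qed
    have \<sigma>L: "?\<sigma> i \<in> L" if "i \<in> {1..l}" for i
    proof -
      have "ls ! (i - 1) \<in> set ls" "i \<in> {1..n+1}" "ys ! (i - 1) = ls ! (i - 1)"
        using that len by (auto simp: l_def ys_def nth_append)
      then show ?thesis using lists \<sigma>_nth by simp
    qed
    have \<sigma>R: "?\<sigma> i \<in> R" if "i \<in> {l+1..k}" for i
    proof -
      have "rs ! (i - 1 - l) \<in> set rs" using that by (intro nth_mem) (auto simp: l_def k_def)
      moreover have "i \<in> {1..n+1}" "ys ! (i - 1) = rs ! (i - 1 - l)"
        using that kn by (auto simp: l_def k_def ys_def nth_append)
      ultimately show ?thesis using lists \<sigma>_nth by simp
    qed
    have \<sigma>Q: "?\<sigma> i \<in> Q" if "i \<in> {k+1..n+1}" for i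
    proof -
      have "ss ! (i - 1 - k) \<in> set ss" using that len by (intro nth_mem) (auto simp: ys_def k_def)
      moreover have "i \<in> {1..n+1}" "ys ! (i - 1) = ss ! (i - 1 - k)"
        using that by (auto simp: k_def ys_def nth_append)
      ultimately show ?thesis using lists \<sigma>_nth by simp
    qed
    obtain \<tau> where \<tau>: "\<And>x. ?\<sigma> (\<tau> x) = x" "\<And>x. x \<in> set ys \<Longrightarrow> \<tau> x \<in> {1..length ys}"
      by (rule ex_section_subst_list[of ys]) (rule that; assumption)
    have inv: "image_mset ?\<sigma> (image_mset \<tau> u) = u" for u
      by (simp add: image_mset.compositionality comp_def \<tau>(1))
    define w' where "w' i = image_mset \<tau> (f (?\<sigma> i) - {#?\<sigma> i#})" for i
    define p where "p i = image_mset \<tau> (g (?\<sigma> i) - {#?\<sigma> i, ?\<sigma> i#})" for i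
    define p' where "p' i j = image_mset \<tau> (c (?\<sigma> i) (?\<sigma> j) - {#?\<sigma> i, ?\<sigma> j#})" for i j
    have w'_sub: "set_mset (w' i) \<subseteq> {1..n+1}" if "i \<in> {1..n+1}" for i
    proof -
      have "set_mset (f (?\<sigma> i) - {#?\<sigma> i#}) \<subseteq> set ys"
        using f(2)[OF \<sigma>[OF that]] set_ys by (auto dest: in_diffD)
      then show ?thesis using \<tau>(2) len unfolding w'_def set_image_mset by fastforce
    qed
    \<comment> \<open>The summand \<open>f x\<close> of a linear \<open>x\<close> contains
      \<open>x\<close> exactly once, so dividing by \<open>x\<close> removes it altogether.\<close>
    have w'_lin: "i \<notin># w' i" if i: "i \<in> {1..k}" for i
    proof
      assume "i \<in># w' i"
      then obtain y where y: "y \<in># f (?\<sigma> i) - {#?\<sigma> i#}" "i = \<tau> y" by (auto simp: w'_def)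
      then have "y = ?\<sigma> i" using \<tau>(1) by simp
      then have "0 < count (f (?\<sigma> i) - {#?\<sigma> i#}) (?\<sigma> i)" using y(1) by (simp only: count_greater_zero_iff)
      moreover have "?\<sigma> i \<in> L \<union> R" using i \<sigma>L[of i] \<sigma>R[of i] by (cases "i \<le> l") auto
      then have "count (f (?\<sigma> i)) (?\<sigma> i) = 1" using f(4) by (auto simp: L_def R_def)
      ultimately show False by simp
    qed
    have adm: "admissible n k w'"
      unfolding admissible_def
    proof (intro conjI ballI)
      fix i assume "i \<in> {1..k}"
      then show "set_mset (w' i) \<subseteq> {1..n+1} - {i}" using w'_sub[of i] w'_lin[of i] kn by auto
    next
      fix i assume "i \<in> {k+1..n+1}"
      then show "set_mset (w' i) \<subseteq> {1..n+1}" using w'_sub[of i] by auto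
    next
      show "vars {q n k} = vars ((\<lambda>i. {#i#} + w' i) ` {1..n+1})"
      proof -
        have "vars ((\<lambda>i. {#i#} + w' i) ` {1..n+1}) = {1..n+1} \<union> (\<Union>i\<in>{1..n+1}. set_mset (w' i))"
          by (auto simp: vars_def)
        also have "\<dots> = {1..n+1}" using w'_sub by blast
        finally show ?thesis using set_mset_q[OF kn] by (simp add: vars_def)
      qed
    qed
    have occ: "image_mset ?\<sigma> ({#i#} + w' i) \<in> v" if "i \<in> {1..n+1}" for i
    proof -
      have "image_mset ?\<sigma> ({#i#} + w' i) = f (?\<sigma> i)"
        using f(3)[OF \<sigma>[OF that]] by (simp add: w'_def inv)
      then show ?thesis using f(1)[OF \<sigma>[OF that]] by simp
    qed
    have sq_in: "image_mset ?\<sigma> (sq i + p i) \<in> v" if "i \<in> {1..l} \<union> {k+1..n+1}" for i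
    proof -
      have "twice_covered (?\<sigma> i) v" using that \<sigma>L \<sigma>Q sq_cov by (auto simp: L_def Q_def)
      note gi = g[OF this]
      have "image_mset ?\<sigma> (sq i + p i) = {#?\<sigma> i, ?\<sigma> i#} + (g (?\<sigma> i) - {#?\<sigma> i, ?\<sigma> i#})"
        by (simp add: sq_def p_def inv)
      also have "\<dots> = g (?\<sigma> i)" using gi by (intro subset_mset.add_diff_inverse) simp
      finally show ?thesis using gi by simp
    qed
    have pair_in: "image_mset ?\<sigma> ({#i, j#} + p' i j) \<in> v" if ij: "l + 1 \<le> i" "i < j" "j \<le> k" for i j
    proof -
      have "?\<sigma> i \<in> R" "?\<sigma> j \<in> R" "?\<sigma> i \<noteq> ?\<sigma> j"
        using \<sigma>R[of i] \<sigma>R[of j] \<sigma>_inj[of i j] ij kn by auto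
      then have cij: "c (?\<sigma> i) (?\<sigma> j) \<in> v \<and> {#?\<sigma> i, ?\<sigma> j#} \<subseteq># c (?\<sigma> i) (?\<sigma> j)"
        by (intro c) (auto simp: R_def)
      have "image_mset ?\<sigma> ({#i, j#} + p' i j) =
          {#?\<sigma> i, ?\<sigma> j#} + (c (?\<sigma> i) (?\<sigma> j) - {#?\<sigma> i, ?\<sigma> j#})"
        by (simp add: p'_def inv)
      also have "\<dots> = c (?\<sigma> i) (?\<sigma> j)" using cij by (intro subset_mset.add_diff_inverse) simp
      finally show ?thesis using cij by simp
    qed
    \<comment> \<open>Letters in \<open>Q\<close> are counted once in \<open>ys\<close> and once
      more in \<open>ss\<close>, linear letters only in \<open>ys\<close>.\<close>
    have eq: "min 2 (count (image_mset ?\<sigma> (q n k)) x) = min 2 (count w x)" for x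
    proof -
      have img: "image_mset ?\<sigma> (q n k) = mset ys + mset ss"
        unfolding image_subst_list_q[OF len kn] by (simp add: ys_def k_def)
      have ys1: "count (mset ys) x = (if x \<in># w then 1 else 0)"
        using dist set_ys by (metis distinct_count_atmost_1)
      have ss1: "count (mset ss) x = (if x \<in> Q then 1 else 0)"
        using lists by (metis distinct_count_atmost_1)
      have mem: "x \<in># w \<longleftrightarrow> 0 < count w x" "x \<in> Q \<longleftrightarrow> 2 \<le> count w x"
        by (auto simp: Q_def intro: count_inI)
      show ?thesis unfolding img count_union ys1 ss1 mem by (simp only: min_def split: if_splits) linarith
    qed
    show ?thesis
    \<comment> \<open>The identities require at least two variables. If \<open>w\<close> is a single
      linear variable, the first condition of \<open>covers\<close> forces \<open>f x = w\<close>,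
      so \<open>w\<close> is itself a summand of \<open>v\<close>.\<close>
    proof (cases "n = 0")
      case True
      then obtain x where ys_x: "ys = [x]" using len by (cases ys) auto
      then have "set_mset w = {x}" using set_ys by simp
      moreover have "?\<sigma> 1 \<in> L \<union> R" using \<sigma>L[of 1] \<sigma>R[of 1] k1 by (cases "1 \<le> l") auto
      then have "count w x = 1" using ys_x by (auto simp: subst_list_def L_def R_def)
      ultimately have x: "set_mset w = {x}" "count w x = 1" by auto
      have single: "u = {#x#}" if "set_mset u \<subseteq> {x}" "count u x = 1" for u
      proof (rule multiset_eqI)
        show "count u y = count {#x#} y" for y
          using that by (cases "y = x") (auto simp: not_in_iff[symmetric])
      qed
      have "f x = w" using single[of w] single[of "f x"] f(2,4)[of x] x by simp
      then have "w \<in> v" using f(1)[of x] x by simp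
      then show ?thesis by (simp add: insert_absorb)
    next
      case False
      then have n: "1 \<le> n" by simp
      show ?thesis
      \<comment> \<open>This asks whether at least two linear variables lack a covered square: then
        (5) applies with the pair summands, otherwise (4).\<close>
      proof (cases "l < k - 1")
        case True
        let ?r = "{{#i, j#} + p' i j | i j. l + 1 \<le> i \<and> i < j \<and> j \<le> k}"
        let ?t = "(\<lambda>i. {#i#} + w' i) ` {1..n+1} \<union> (\<lambda>i. sq i + p i) ` {1..l} \<union> ?r \<union>
          (\<lambda>i. sq i + p i) ` {k+1..n+1}"
        have "?r \<subseteq> (\<lambda>(i, j). {#i, j#} + p' i j) ` ({..k} \<times> {..k})" by force
        then have "finite ?r" by (rule finite_subset) simp
        then have t: "?t \<in> carr term_alg" by (auto simp: carr_term_alg sq_def)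
        have le: "satisfies_le S {q n k} ?t"
          using id5[unfolded identity5_def, rule_format, OF n k True adm] .
        have "rename ?\<sigma> ?t \<subseteq> v"
          unfolding rename_def using occ sq_in pair_in by (intro image_subsetI) blast
        from satisfies_le_substitution[OF id1 h le q_nonempty[OF kn] t v this eq w] show ?thesis .
      next
        case False
        let ?t = "(\<lambda>i. {#i#} + w' i) ` {1..n+1} \<union> (\<lambda>i. sq i + p i) ` {1..k-1} \<union>
          (\<lambda>i. sq i + p i) ` {k+1..n+1}"
        have t: "?t \<in> carr term_alg" by (auto simp: carr_term_alg sq_def)
        have le: "satisfies_le S {q n k} ?t"
          using id4[unfolded identity4_def, rule_format, OF n k adm] .
        \<comment> \<open>At most the last linear variable lacks a covered square, and (4) does not
          ask for the square at \<open>k\<close>.\<close>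
        have "{1..k-1} \<subseteq> {1..l}" using False by auto
        then have "rename ?\<sigma> ?t \<subseteq> v"
          unfolding rename_def using occ sq_in by (intro image_subsetI) blast
        from satisfies_le_substitution[OF id1 h le q_nonempty[OF kn] t v this eq w] show ?thesis .
      qed
    qed
  qed
qed

section \<open>From inequalities for single words to identities\<close>

lemma hom_Un_absorb:
  assumes h: "h \<in> alg_hom term_alg S" and v: "v \<in> carr term_alg" and u: "u \<in> carr term_alg"
    and le: "\<And>w. w \<in> u \<Longrightarrow> h v = h (v \<union> {w})"
  shows "h (v \<union> u) = h v"
proof -
  have "h (v \<union> u') = h v" if "finite u'" "u' \<subseteq> u" for u'
    using that
  proof (induction u' rule: finite_induct)
    case (insert w u')
    have w: "{w} \<in> carr term_alg" and vu: "v \<union> u' \<in> carr term_alg"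
      using insert u v by (auto simp: carr_term_alg)
    have "h (v \<union> insert w u') = h (v \<union> u' \<union> {w})" by (rule arg_cong[of _ _ h]) blast
    also have "\<dots> = h (v \<union> {w})"
      unfolding hom_Un[OF h vu w] hom_Un[OF h v w] using insert by simp
    also have "\<dots> = h v" by (rule le[symmetric]) (use insert.prems in simp)
    finally show ?case .
  qed simp
  then show ?thesis using u by (simp add: carr_term_alg)
qed

text \<open>Each side absorbs every word of the other in \<open>S\<close>, so both have the value of
  their union.\<close>

lemma satisfies_eq_if_P7_satisfies_eq:
  assumes "identity1 S" "identity3 S" "identity4 S" "identity5 S"
    and u: "u \<in> carr term_alg" and v: "v \<in> carr term_alg" and eq: "satisfies_eq P7 u v"
  shows "satisfies_eq S u v"
  unfolding satisfies_eq_def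
proof
  fix h assume h: "h \<in> alg_hom term_alg S"
  have absorb: "h (v \<union> u) = h v"
    if u: "u \<in> carr term_alg" and v: "v \<in> carr term_alg" and eq: "satisfies_eq P7 u v" for u v
  proof (rule hom_Un_absorb[OF h v u])
    fix w assume w: "w \<in> u"
    then have ne: "w \<noteq> {#}" using u by (auto simp: carr_term_alg)
    have "g {w} \<subseteq> g v" if g: "g \<in> alg_hom term_alg P7" for g
    proof -
      have "g {w} \<subseteq> g u" using hom_P7_Union[OF g u] w by blast
      also have "g u = g v" using eq g unfolding satisfies_eq_def by blast
      finally show ?thesis .
    qed
    then have "covers v w"
      by (intro satisfies_le_P7_imp_covers[OF v ne]) (simp add: satisfies_le_P7_iff_subset[OF v ne])
    then show "h v = h (v \<union> {w})" by (rule covers_imp_hom_le[OF assms(1-4) h v ne])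
  qed
  have "satisfies_eq P7 v u" using eq unfolding satisfies_eq_def by metis
  then show "h u = h v" using absorb[OF u v eq] absorb[OF v u] by (simp add: Un_commute)
qed

lemma identity_generated_variety:
  assumes S: "S \<in> generated_variety P7"
  shows "identity1 S" "identity3 S" "identity4 S" "identity5 S"
proof -
  note transfer = satisfies_eq_generated_variety[OF comm_ai_semiring_P7 S]
  have le: "satisfies_le S {u} v" if "satisfies_le P7 {u} v" "u \<noteq> {#}" "v \<in> carr term_alg" for u v
    using that unfolding satisfies_le_def
    by (intro transfer) (auto simp: carr_term_alg)
  show "identity1 S"
    using identity1_P7 unfolding identity1_def by (intro transfer) (simp_all add: carr_term_alg)
  have q0: "(\<Sum>i=1..n+1. sq i) = q n 0" for n by (simp add: q_def)
  show "identity3 S"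
    unfolding identity3_def q0
  proof (intro allI impI le)
    fix n :: nat and w p :: "nat \<Rightarrow> word"
    assume "1 \<le> n" "\<forall>i\<in>{1..n+1}. set_mset (w i) \<subseteq> {1..n+1}"
    then show "satisfies_le P7 {q n 0} ((\<lambda>i. {#i#} + w i) ` {1..n+1} \<union> (\<lambda>i. sq i + p i) ` {1..n+1})"
      using identity3_P7 unfolding identity3_def q0 by blast
  qed (auto simp: carr_term_alg sq_def q_nonempty)
  show "identity4 S"
    unfolding identity4_def
  proof (intro allI ballI impI le)
    fix n k :: nat and w p :: "nat \<Rightarrow> word"
    assume "1 \<le> n" "k \<in> {1..n+1}" "admissible n k w"
    then show "satisfies_le P7 {q n k} ((\<lambda>i. {#i#} + w i) ` {1..n+1} \<union> (\<lambda>i. sq i + p i) ` {1..k-1} \<union>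
        (\<lambda>i. sq i + p i) ` {k+1..n+1})"
      using identity4_P7 unfolding identity4_def by blast
  qed (auto simp: carr_term_alg sq_def q_nonempty)
  show "identity5 S"
    unfolding identity5_def
  proof (intro allI ballI impI le)
    fix n k l :: nat and w p :: "nat \<Rightarrow> word" and p' :: "nat \<Rightarrow> nat \<Rightarrow> word"
    assume "1 \<le> n" and k: "k \<in> {1..n+1}" and "l < k - 1" "admissible n k w"
    let ?r = "{{#i, j#} + p' i j | i j. l + 1 \<le> i \<and> i < j \<and> j \<le> k}"
    let ?v = "(\<lambda>i. {#i#} + w i) ` {1..n+1} \<union> (\<lambda>i. sq i + p i) ` {1..l} \<union> ?r \<union>
      (\<lambda>i. sq i + p i) ` {k+1..n+1}"
    show "satisfies_le P7 {q n k} ?v"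
      using identity5_P7[unfolded identity5_def, rule_format] \<open>1 \<le> n\<close> k \<open>l < k - 1\<close> \<open>admissible n k w\<close> .
    show "q n k \<noteq> {#}" using k by (intro q_nonempty) simp
    have "?r \<subseteq> (\<lambda>(i, j). {#i, j#} + p' i j) ` ({..k} \<times> {..k})" by force
    then have "finite ?r" by (rule finite_subset) simp
    then show "?v \<in> carr term_alg" by (auto simp: carr_term_alg sq_def)
  qed
qed

theorem proposition4p7:
  "generated_variety (power_semiring :: s7 set alg) =
     {S :: 'b alg. comm_ai_semiring S \<and> identity1 S \<and> identity2 S \<and> identity3 S \<and>
        identity4 S \<and> identity5 S}"
proof (intro set_eqI iffI)
  fix S :: "'b alg"
  assume S: "S \<in> generated_variety P7"
  show "S \<in> {S. comm_ai_semiring S \<and> identity1 S \<and> identity2 S \<and> identity3 S \<and>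
      identity4 S \<and> identity5 S}"
    using comm_ai_semiring_generated_variety[OF comm_ai_semiring_P7 S]
      identity_generated_variety[OF S] identity2_if_identity3 by blast
next
  fix S :: "'b alg"
  assume "S \<in> {S. comm_ai_semiring S \<and> identity1 S \<and> identity2 S \<and> identity3 S \<and>
      identity4 S \<and> identity5 S}"
  then show "S \<in> generated_variety P7"
    by (intro in_generated_varietyI[OF comm_ai_semiring_P7])
      (auto intro: satisfies_eq_if_P7_satisfies_eq)
qed

end
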